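(* Let $m_1,m_2,\ldots$ be nonnegative integers with $m_1,m_2,m_3>0$ such that the power series $M(z)=\sum_{i\ge 1} m_i z^i/i!$ has strictly positive radius of convergence, and consider the $M$-assembly. Fix $t>0$ and a sequence of integers $k(1),k(2),\dots\ge 1$ such that $n-k(n)\sim t\sqrt n$ as $n\to\infty$. Given $n$, with $k=k(n)$, pick an assembly uniformly from the $p(n,k)$ $M$-assemblies of size $n$ having exactly $k$ components. Let $L_1$ be the size of its largest component and $D_3(n,k)$ the number of its components of size $3$. Put $$\lambda\equiv\lambda(t,M):=\frac{2m_1m_3}{3m_2^2}\,t^2 .$$ Then, as $n\to\infty$: (1) with probability tending to $1$, the largest component has size $2$ or $3$, i.e. $\mathbb P(L_1\in\{2,3\})\to 1$; (2) $D_3(n,k)$ converges in distribution to the Poisson distribution with mean $\lambda(t,M)$; (3) hence $\mathbb P(L_1=2)\to \exp(-\lambda(t,M))$; (4) the error in the approximation in (3), and indeed the total variation distance $d_{\rm TV}\bigl(D_3(n,k),\mathrm{Poisson}(\lambda)\bigr)$ between the ingredients in (2), is at most $O_t\bigl((\log^2 n)/\sqrt n\bigr)$.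
   Context: Given nonnegative integers $m_1,m_2,\ldots$ with exponential generating function $M(z)=\sum_{i\ge1}m_iz^i/i!$, an $M$-assembly of size $n$ is obtained by choosing a set partition of $\{1,\dots,n\}$ into nonempty blocks and, for each block of size $i$, choosing one of $m_i$ possible decorations. The decorated blocks are the components; the size of a component is the size of its block. $p(n,k)$ is the number of $M$-assemblies of size $n$ with exactly $k$ components; equivalently $\sum_{n,k\ge0}p(n,k)z^n\theta^k/n!=e^{\theta M(z)}$. $a_n\sim b_n$ means $a_n/b_n\to1$. $d_{\rm TV}$ is the total variation distance between the laws of integer-valued random variables. $O_t$ indicates that the implicit constant may depend on $t$ (and on the assembly $M$, which is considered fixed).
   Formalization: Part (4) is false for general k(n), e.g. n-k(n)=⌊t√n+n^0.4⌋. With t_n=(n-k(n))/√n, the bound O_t(log²n/√n) is given with λ(t_n,M) in place of λ(t,M), and with λ(t,M) the bound is O_t(log²n/√n+|t_n-t|). *)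

theory Defs
  imports
    "HOL-Probability.Probability"
    "HOL-Library.Landau_Symbols"
    "HOL-Library.Disjoint_Sets"
begin

text \<open>
  The generating function \<open>M(z) = (\<Sum>i\<ge>1. m i * z ^ i / i!)\<close>; the value \<open>m 0\<close> plays no role.
\<close>

definition assembly_egf :: "(nat \<Rightarrow> nat) \<Rightarrow> real fps" where
  "assembly_egf m = Abs_fps (\<lambda>i. if i = 0 then 0 else real (m i) / fact i)"

text \<open>
  An assembly is a pair of a set partition and a decoration of its blocks. Decorations are
  extensional functions (equal to \<open>undefined\<close> off the partition), so that distinct pairs are
  distinct assemblies and the number of pairs over a partition \<open>P\<close> is \<open>(\<Prod>B\<in>P. m (card B))\<close>.
\<close>

type_synonym assembly = "nat set set \<times> (nat set \<Rightarrow> nat)"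

definition assemblies :: "(nat \<Rightarrow> nat) \<Rightarrow> nat \<Rightarrow> nat \<Rightarrow> assembly set" where
  "assemblies m n k =
     {(P, d). partition_on {1..n} P \<and> card P = k \<and> d \<in> (\<Pi>\<^sub>E B\<in>P. {..<m (card B)})}"

lemma finite_assemblies: "finite (assemblies m n k)"
proof (rule finite_subset)
  show "assemblies m n k \<subseteq>
      Sigma {P. partition_on {1..n} P} (\<lambda>P. \<Pi>\<^sub>E B\<in>P. {..<m (card B)})"
    by (auto simp: assemblies_def)
  show "finite (Sigma {P. partition_on {1..n} P} (\<lambda>P. \<Pi>\<^sub>E B\<in>P. {..<m (card B)}))"
    by (intro finite_SigmaI finitely_many_partition_on finite_PiE)
       (auto intro: finite_elements)
qed

text \<open>
  The uniform distribution below is meaningful only where \<open>assemblies m n k\<close> is nonempty.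
\<close>

definition random_assembly :: "(nat \<Rightarrow> nat) \<Rightarrow> nat \<Rightarrow> nat \<Rightarrow> assembly pmf" where
  "random_assembly m n k = pmf_of_set (assemblies m n k)"

definition largest_component :: "assembly \<Rightarrow> nat" where
  "largest_component a = Max (card ` fst a)"

definition components_of_size :: "nat \<Rightarrow> assembly \<Rightarrow> nat" where
  "components_of_size i a = card {B \<in> fst a. card B = i}"

definition D3_pmf :: "(nat \<Rightarrow> nat) \<Rightarrow> nat \<Rightarrow> nat \<Rightarrow> nat pmf" where
  "D3_pmf m n k = map_pmf (components_of_size 3) (random_assembly m n k)"

definition total_variation :: "'a pmf \<Rightarrow> 'a pmf \<Rightarrow> real" where
  "total_variation p q = (SUP A. \<bar>measure_pmf.prob p A - measure_pmf.prob q A\<bar>)"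

definition assembly_lambda :: "real \<Rightarrow> (nat \<Rightarrow> nat) \<Rightarrow> real" where
  "assembly_lambda t m = 2 * real (m 1) * real (m 3) / (3 * real (m 2) ^ 2) * t ^ 2"

text \<open>
  The sequences \<open>k(1), k(2), \<dots> \<ge> 1\<close> with \<open>n - k(n) \<sim> t \<surd>n\<close>. The subtraction is taken in the reals,
  and the value \<open>k 0\<close> is irrelevant.
\<close>

definition component_seq :: "real \<Rightarrow> (nat \<Rightarrow> nat) \<Rightarrow> bool" where
  "component_seq t k \<longleftrightarrow>
     (\<forall>n\<ge>1. k n \<ge> 1) \<and> (\<lambda>n. real n - real (k n)) \<sim>[at_top] (\<lambda>n. t * sqrt (real n))"

text \<open>
  The value of \<open>t\<close> at which \<open>n - k = t \<surd>n\<close> holds exactly. It tends to \<open>t\<close> along every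
  \<open>component_seq t k\<close>, but possibly more slowly than any prescribed rate, so an error
  bound for the approximation with parameter \<open>t\<close> has to include \<open>\<bar>exact_t n k - t\<bar>\<close>.
\<close>

definition exact_t :: "nat \<Rightarrow> nat \<Rightarrow> real" where
  "exact_t n k = (real n - real k) / sqrt (real n)"

end

theory Submission
  imports Defs "HOL-Real_Asymp.Real_Asymp"
begin

text \<open>
  Let \<open>p(n,k)\<close> be the number of assemblies and \<open>r = n - k\<close>. Marking a component of size \<open>i\<close> gives
  \<open>\<Sum>\<^sub>a D\<^sub>i(a) = (n choose i) m\<^sub>i p(n-i,k-1)\<close>, and the same identity holds within every class of
  assemblies given by the multiset of component sizes. As \<open>D\<^sub>1 \<ge> n - 2r\<close> and \<open>D\<^sub>2 \<le> r\<close>, the cases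
  \<open>i = 1, 2\<close> bound quotients of values of \<open>p\<close>, so that \<open>E D\<^sub>i = O(n (K r / n)^(i-1))\<close> for a constant
  \<open>K\<close>, and a component of size at least 4 has probability \<open>O(r^3 / n^2) = O(1 / \<surd>n)\<close>. If there is
  none, then \<open>j = D\<^sub>3\<close> determines \<open>D\<^sub>1 = n - 2r + j\<close> and \<open>D\<^sub>2 = r - 2j\<close>, and the cases
  \<open>i = 1, 2, 3\<close> of the identity combine to \<open>(j+1) N(j+1) = l(j) N(j)\<close> for the number \<open>N(j)\<close> of these
  assemblies, where \<open>l(j) = \<lambda> + O((j+1) / \<surd>n)\<close>. This is the recurrence of the Poisson weights up to
  a perturbation, which changes the distribution by \<open>O(1 / \<surd>n)\<close> in total variation.
\<close>

section \<open>Set partitions and their block sizes\<close>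

text \<open>The number of decorations and the events of interest depend on a partition only through
  this multiset. Sums over partitions therefore see only the cardinality of the ground set.\<close>

definition block_sizes :: "nat set set \<Rightarrow> nat multiset" where
  "block_sizes P = image_mset card (mset_set P)"

lemma size_block_sizes: "size (block_sizes P) = card P"
  by (simp add: block_sizes_def)

lemma set_block_sizes: "finite P \<Longrightarrow> set_mset (block_sizes P) = card ` P"
  by (simp add: block_sizes_def)

lemma count_block_sizes:
  assumes "finite P"
  shows "count (block_sizes P) i = card {B \<in> P. card B = i}"
proof -
  have "{B \<in> P. card B = i} = {B. B \<in># mset_set P \<and> i = card B}" 
    using assms by auto
  thus ?thesis
    using assms by (simp add: block_sizes_def count_image_mset')
qed

lemma prod_mset_block_sizes: "(\<Prod>i\<in>#block_sizes P. f i) = (\<Prod>B\<in>P. f (card B))"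
  by (simp add: block_sizes_def prod_unfold_prod_mset image_mset.compositionality comp_def)

lemma block_sizes_insert: "finite P \<Longrightarrow> B \<notin> P \<Longrightarrow> block_sizes (insert B P) = add_mset (card B) (block_sizes P)"
  by (simp add: block_sizes_def)

lemma block_sizes_image:
  assumes "partition_on S P" "inj_on f S"
  shows "block_sizes ((`) f ` P) = block_sizes P"
proof -
  have inj: "inj_on ((`) f) P"
    using assms by (intro inj_on_image) (auto simp: partition_on_def)
  have "block_sizes ((`) f ` P) = image_mset (card \<circ> (`) f) (mset_set P)"
    by (simp add: block_sizes_def image_mset_mset_set[OF inj, symmetric] image_mset.compositionality)
  also have "\<dots> = block_sizes P"
    unfolding block_sizes_def
  proof (rule image_mset_cong)
    fix B assume "B \<in># mset_set P"
    hence "B \<in> P"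
      by (metis elem_mset_set empty_iff mset_set.infinite set_mset_empty)
    hence "B \<subseteq> S" using assms(1) by (auto simp: partition_on_def)
    thus "(card \<circ> (`) f) B = card B"
      using assms(2) by (simp add: card_image inj_on_subset)
  qed
  finally show ?thesis .
qed

lemma partition_block_sizes:
  assumes "partition_on S P" "finite S"
  shows "0 \<notin># block_sizes P" "sum_mset (block_sizes P) = card S"
proof -
  have fin: "finite P" using assms finite_elements by blast
  have finB: "finite B" if "B \<in> P" for B 
    using that assms by (metis Union_upper finite_subset partition_onD1)
  show "0 \<notin># block_sizes P"
    using partition_onD3[OF assms(1)] finB by (auto simp: set_block_sizes[OF fin])
  show "sum_mset (block_sizes P) = card S"
    using product_partition[OF assms(1) finB]
    by (simp add: block_sizes_def sum_unfold_sum_mset)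
qed

text \<open>A bijection from \<open>S\<close> to \<open>T\<close>, applied blockwise, is a bijection
  between their partitions that preserves block sizes. It serves to rename the elements left over
  after the removal of a block to an initial segment.\<close>

lemma sum_partitions_card_eq:
  fixes g :: "nat multiset \<Rightarrow> 'a::comm_monoid_add"
  assumes "finite S" "finite T" "card S = card T"
  shows "(\<Sum>P | partition_on S P. g (block_sizes P)) = (\<Sum>P | partition_on T P. g (block_sizes P))"
proof -
  obtain f where f: "bij_betw f S T"
    using assms finite_same_card_bij by blast
  define h where "h = inv_into S f"
  have h: "bij_betw h T S" using f by (simp add: h_def bij_betw_inv_into)
  have im: "partition_on B ((`) f ` P)" if "partition_on A P" "bij_betw f A B" for f A B and P :: "nat set set"
  proof -
    \<comment> \<open>\<open>partition_on_inj_image\<close> discards an empty image block; there is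
      none, because no block of \<open>P\<close> is empty.\<close>
    have "partition_on (f ` A) ((`) f ` P - {{}})"
      using that by (intro partition_on_inj_image) (auto simp: bij_betw_def)
    moreover have "(`) f ` P - {{}} = (`) f ` P" 
      using that(1) by (auto simp: partition_on_def)
    ultimately show ?thesis using that(2) by (simp add: bij_betw_def)
  qed
  have inv: "(`) h ` (`) f ` P = P" if "partition_on A P" and hf: "\<And>x. x \<in> A \<Longrightarrow> h (f x) = x" for f h :: "nat \<Rightarrow> nat" and A P
  proof -
    have *: "h ` f ` B = B" if "B \<in> P" for B
    proof -
      have "B \<subseteq> A"
        using that \<open>partition_on A P\<close> by (auto simp: partition_on_def)
      thus ?thesis using hf by (force simp: image_image)
    qed
    thus ?thesis by (auto simp: image_image image_iff)
  qed
  have hf: "h (f x) = x" if "x \<in> S" for x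
    using that f by (simp add: h_def bij_betw_def)
  have fh: "f (h x) = x" if "x \<in> T" for x
    using that f by (simp add: h_def bij_betw_inv_into_right)
  show ?thesis
  proof (rule sum.reindex_bij_witness[where i = "\<lambda>P. (`) h ` P" and j = "\<lambda>P. (`) f ` P"])
    fix P assume "P \<in> {P. partition_on S P}"
    hence P: "partition_on S P" by simp
    show "(`) h ` (`) f ` P = P" by (rule inv[OF P]) (rule hf)
    show "(`) f ` P \<in> {P. partition_on T P}" using im[OF P f] by simp
    show "g (block_sizes ((`) f ` P)) = g (block_sizes P)"
      using P f by (simp add: block_sizes_image bij_betw_def)
  next
    fix P assume "P \<in> {P. partition_on T P}"
    hence P: "partition_on T P" by simp
    show "(`) f ` (`) h ` P = P" by (rule inv[OF P]) (rule fh)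
    show "(`) h ` P \<in> {P. partition_on S P}" using im[OF P h] by simp
  qed
qed

text \<open>
  Both sides count partitions of \<open>{1..n}\<close> with a marked block of size \<open>i\<close>, which the right-hand
  side chooses first.
\<close>
lemma sum_partitions_marked_block:
  fixes g :: "nat multiset \<Rightarrow> real"
  assumes "i > 0"
  shows "(\<Sum>P | partition_on {1..n} P. real (count (block_sizes P) i) * g (block_sizes P)) =
         real (n choose i) * (\<Sum>P | partition_on {1..n-i} P. g (add_mset i (block_sizes P)))"
proof -
  let ?S = "{1..n}"
  have fin: "finite P" if "partition_on ?S P" for P
    using that finite_elements by blast
  have "(\<Sum>P | partition_on ?S P. real (count (block_sizes P) i) * g (block_sizes P)) =
        (\<Sum>P | partition_on ?S P. \<Sum>B | B \<in> P \<and> card B = i. g (block_sizes P))"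
    by (intro sum.cong refl) (auto simp: count_block_sizes fin)
  also have "\<dots> = (\<Sum>(P,B) \<in> (SIGMA P:{P. partition_on ?S P}. {B \<in> P. card B = i}). g (block_sizes P))"
    by (subst sum.Sigma) (auto simp del: One_nat_def intro: finitely_many_partition_on dest: fin)
  also have "\<dots> = (\<Sum>(B,P) \<in> (SIGMA B:{B. B \<subseteq> ?S \<and> card B = i}. {P. partition_on (?S - B) P}). 
                     g (add_mset i (block_sizes P)))"
  proof (rule sum.reindex_bij_witness[where j = "\<lambda>(P,B). (B, P - {B})" and i = "\<lambda>(B,P). (insert B P, B)"])
    fix a assume a: "a \<in> (SIGMA P:{P. partition_on ?S P}. {B \<in> P. card B = i})"
    obtain P B where PB: "a = (P,B)" "partition_on ?S P" "B \<in> P" "card B = i"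
      using a by auto
    have dj: "disjnt B (\<Union>(P - {B}))"
      using PB by (force simp: partition_on_def disjoint_def disjnt_def)
    have "partition_on (?S - B) (P - {B})" "B \<subseteq> ?S"
      using PB partition_on_insert[OF dj, of ?S] by (auto simp: insert_absorb)
    thus "(case a of (P,B) \<Rightarrow> (B, P - {B})) \<in> (SIGMA B:{B. B \<subseteq> ?S \<and> card B = i}. {P. partition_on (?S - B) P})"
      using PB by auto
    show "(case case a of (P,B) \<Rightarrow> (B, P - {B}) of (B,P) \<Rightarrow> (insert B P, B)) = a"
      using PB by auto
    have "block_sizes P = add_mset i (block_sizes (P - {B}))"
      using block_sizes_insert[of "P - {B}" B] PB fin[OF PB(2)] by (auto simp: insert_absorb)
    thus "(case case a of (P,B) \<Rightarrow> (B, P - {B}) of (B,P) \<Rightarrow> g (add_mset i (block_sizes P))) =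
          (case a of (P,B) \<Rightarrow> g (block_sizes P))"
      using PB by simp
  next
    fix b assume b: "b \<in> (SIGMA B:{B. B \<subseteq> ?S \<and> card B = i}. {P. partition_on (?S - B) P})"
    obtain P B where PB: "b = (B,P)" "partition_on (?S - B) P" "B \<subseteq> ?S" "card B = i"
      using b by auto
    \<comment> \<open>Here \<open>i > 0\<close> matters: a nonempty block disjoint from all others
      is not one of them, so inserting it and removing it are inverse operations.\<close>
    have ne: "B \<noteq> {}" using PB assms by auto
    have dj: "disjnt B (\<Union>P)" using PB by (auto simp: partition_on_def disjnt_def)
    have nin: "B \<notin> P" using dj ne by (auto simp: disjnt_def)
    show "(case case b of (B,P) \<Rightarrow> (insert B P, B) of (P,B) \<Rightarrow> (B, P - {B})) = b"
      using PB nin by auto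
    show "(case b of (B,P) \<Rightarrow> (insert B P, B)) \<in> (SIGMA P:{P. partition_on ?S P}. {B \<in> P. card B = i})"
      using PB ne partition_on_insert[OF dj, of ?S] by auto
  qed
  also have "\<dots> = (\<Sum>B | B \<subseteq> ?S \<and> card B = i. \<Sum>P | partition_on (?S - B) P. g (add_mset i (block_sizes P)))"
    by (subst sum.Sigma) (auto intro: finitely_many_partition_on)
  also have "\<dots> = (\<Sum>B | B \<subseteq> ?S \<and> card B = i. \<Sum>P | partition_on {1..n-i} P. g (add_mset i (block_sizes P)))"
  proof (rule sum.cong[OF refl])
    fix B assume "B \<in> {B. B \<subseteq> ?S \<and> card B = i}"
    hence "card (?S - B) = card {1..n-i}"
      by (auto simp: card_Diff_subset finite_subset)
    thus "(\<Sum>P | partition_on (?S - B) P. g (add_mset i (block_sizes P))) = 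
          (\<Sum>P | partition_on {1..n-i} P. g (add_mset i (block_sizes P)))"
      by (intro sum_partitions_card_eq[where g = "\<lambda>M. g (add_mset i M)"]) auto
  qed
  also have "\<dots> = real (n choose i) * (\<Sum>P | partition_on {1..n-i} P. g (add_mset i (block_sizes P)))"
    by (simp add: n_subsets)
  finally show ?thesis .
qed

text \<open>The excess \<open>sum_mset M - size M\<close> is the sum of \<open>x - 1\<close> over
  the elements \<open>x\<close>. An element other than 1 contributes at least 1 to it, a 2 exactly
  1, and a single \<open>i\<close> already \<open>i - 1\<close>.\<close>

lemma size_count_bounds:
  fixes M :: "nat multiset"
  assumes "0 \<notin># M"
  shows "2 * size M \<le> sum_mset M + count M 1" "count M 2 + size M \<le> sum_mset M" 
        "count M 1 \<le> size M" "i \<in># M \<Longrightarrow> i + size M \<le> Suc (sum_mset M)" "size M \<le> sum_mset M"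
proof -
  have a: "2 * size M \<le> sum_mset M + count M 1 \<and> count M 2 + size M \<le> sum_mset M
     \<and> count M 1 \<le> size M \<and> size M \<le> sum_mset M \<and> (\<forall>i. i \<in># M \<longrightarrow> i + size M \<le> Suc (sum_mset M))"
    using assms
  proof (induction M)
    case (add x M)
    hence "x > 0" by auto
    then show ?case using add by (auto split: if_splits)
  qed auto
  show "2 * size M \<le> sum_mset M + count M 1" "count M 2 + size M \<le> sum_mset M" 
        "count M 1 \<le> size M" "i \<in># M \<Longrightarrow> i + size M \<le> Suc (sum_mset M)" "size M \<le> sum_mset M" using a by blast+
qed

text \<open>Given size and sum, these two linear equations determine the numbers of 1s and 2s from
  the number of 3s. This makes the marking identity exact on the classes with fixed
  \<open>count M 3\<close>.\<close>

lemma size_sum_small: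
  fixes M :: "nat multiset"
  assumes "0 \<notin># M" "\<forall>x\<in>#M. x \<le> 3"
  shows "size M = count M 1 + count M 2 + count M 3" 
        "sum_mset M = count M 1 + 2 * count M 2 + 3 * count M 3"
proof -
  have "size M = count M 1 + count M 2 + count M 3 \<and> sum_mset M = count M 1 + 2 * count M 2 + 3 * count M 3"
    using assms
  proof (induction M)
    case (add x M)
    hence "x = 1 \<or> x = 2 \<or> x = 3" by (auto simp: numeral_eq_Suc le_Suc_eq)
    then show ?case using add by auto
  qed auto
  thus "size M = count M 1 + count M 2 + count M 3" 
        "sum_mset M = count M 1 + 2 * count M 2 + 3 * count M 3" by blast+
qed

section \<open>Weighted counts of assemblies\<close>

text \<open>The predicate \<open>R\<close> acts on block sizes only, so that one marking identity
  serves for the total count, for the classes with fixed \<open>D_3\<close>, and for assemblies with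
  a large component.\<close>

definition assembly_count :: "(nat \<Rightarrow> nat) \<Rightarrow> (nat multiset \<Rightarrow> bool) \<Rightarrow> nat \<Rightarrow> nat \<Rightarrow> real" where
  "assembly_count m R n k = (\<Sum>P | partition_on {1..n} P.
     if size (block_sizes P) = k \<and> R (block_sizes P) then real (\<Prod>i\<in>#block_sizes P. m i) else 0)"

lemma card_assemblies:
  "real (card {a \<in> assemblies m n k. R (block_sizes (fst a))}) = assembly_count m R n k"
proof -
  let ?Q = "{P. partition_on {1..n} P \<and> card P = k \<and> R (block_sizes P)}"
  have fin: "finite {P. partition_on {1..n} P}" by (simp add: finitely_many_partition_on)
  have finQ: "finite ?Q" by (rule finite_subset[OF _ fin]) auto
  have finP: "finite P" if "partition_on {1..n} P" for P
    using that finite_elements by blast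
  have "{a \<in> assemblies m n k. R (block_sizes (fst a))} = (SIGMA P:?Q. \<Pi>\<^sub>E B\<in>P. {..<m (card B)})"
    by (auto simp: assemblies_def)
  hence "card {a \<in> assemblies m n k. R (block_sizes (fst a))} = (\<Sum>P\<in>?Q. card (\<Pi>\<^sub>E B\<in>P. {..<m (card B)}))"
    using finQ by (simp add: card_SigmaI finite_PiE finP)
  also have "\<dots> = (\<Sum>P\<in>?Q. \<Prod>i\<in>#block_sizes P. m i)"
    by (intro sum.cong refl) (simp add: card_PiE finP prod_mset_block_sizes)
  also have "real \<dots> = (\<Sum>P\<in>?Q. real (\<Prod>i\<in>#block_sizes P. m i))" by simp
  also have "\<dots> = assembly_count m R n k"
    unfolding assembly_count_def size_block_sizes
    by (subst sum.inter_filter[OF fin, symmetric]) simp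
  finally show ?thesis .
qed

text \<open>Adding the marked block to the rest multiplies the weight by \<open>m i\<close> and
  raises the number of blocks by one. The left-hand side is the sum of \<open>D_i\<close> over the
  assemblies of the class.\<close>

lemma assembly_count_marked_block:
  assumes "i > 0"
  shows "(\<Sum>P | partition_on {1..n} P. real (count (block_sizes P) i) * 
            (if size (block_sizes P) = Suc k \<and> R (block_sizes P) then real (\<Prod>i\<in>#block_sizes P. m i) else 0)) =
         real (n choose i) * real (m i) * assembly_count m (\<lambda>M. R (add_mset i M)) (n - i) k"
proof -
  define g where "g M = (if size M = Suc k \<and> R M then real (\<Prod>i\<in>#M. m i) else 0)" for M
  have "g (add_mset i M) = real (m i) * (if size M = k \<and> R (add_mset i M) then real (\<Prod>i\<in>#M. m i) else 0)" for M
    by (simp add: g_def)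
  thus ?thesis
    using sum_partitions_marked_block[OF assms, where n = n and g = g]
    by (simp add: assembly_count_def g_def[symmetric] sum_distrib_left mult.assoc)
qed

lemma assembly_count_nonneg: "assembly_count m R n k \<ge> 0"
  unfolding assembly_count_def by (intro sum_nonneg) auto

text \<open>If \<open>D_i\<close> is constant on the class, the marked sum is this constant times
  the count. The next two lemmas assume only an upper or a lower bound for \<open>D_i\<close> and
  give one inequality each.\<close>

lemma assembly_count_marked_block_eq:
  assumes "i > 0" 
      and "\<And>M. 0 \<notin># M \<Longrightarrow> sum_mset M = n \<Longrightarrow> size M = Suc k \<Longrightarrow> R M \<Longrightarrow> real (count M i) = c"
  shows "c * assembly_count m R n (Suc k) =
         real (n choose i) * real (m i) * assembly_count m (\<lambda>M. R (add_mset i M)) (n - i) k"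
  unfolding assembly_count_marked_block[OF assms(1), symmetric] 
  unfolding assembly_count_def sum_distrib_left
  by (intro sum.cong refl) (auto simp: assms(2) partition_block_sizes)

lemma assembly_count_marked_block_ge:
  assumes "i > 0" 
      and "\<And>M. 0 \<notin># M \<Longrightarrow> sum_mset M = n \<Longrightarrow> size M = Suc k \<Longrightarrow> R M \<Longrightarrow> real (count M i) \<le> c"
  shows "real (n choose i) * real (m i) * assembly_count m (\<lambda>M. R (add_mset i M)) (n - i) k
         \<le> c * assembly_count m R n (Suc k)"
  unfolding assembly_count_marked_block[OF assms(1), symmetric] 
  unfolding assembly_count_def sum_distrib_left
  by (intro sum_mono) (auto simp: assms(2) partition_block_sizes intro!: mult_right_mono)

lemma assembly_count_marked_block_le:
  assumes "i > 0" 
      and "\<And>M. 0 \<notin># M \<Longrightarrow> sum_mset M = n \<Longrightarrow> size M = Suc k \<Longrightarrow> R M \<Longrightarrow> c \<le> real (count M i)"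
  shows "c * assembly_count m R n (Suc k) \<le>
         real (n choose i) * real (m i) * assembly_count m (\<lambda>M. R (add_mset i M)) (n - i) k"
  unfolding assembly_count_marked_block[OF assms(1), symmetric] 
  unfolding assembly_count_def sum_distrib_left
  by (intro sum_mono) (auto simp: assms(2) partition_block_sizes intro!: mult_right_mono)

lemma assembly_count_eq_0:
  assumes "\<And>M. 0 \<notin># M \<Longrightarrow> sum_mset M = n \<Longrightarrow> size M = k \<Longrightarrow> \<not> R M"
  shows "assembly_count m R n k = 0"
  unfolding assembly_count_def using assms
  by (intro sum.neutral) (auto simp: partition_block_sizes)

lemma real_choose_two: "real (n choose 2) = real n * (real n - 1) / 2"
  by (simp add: binomial_gbinomial gbinomial_prod_rev numeral_2_eq_2)

lemma real_choose_three: "real (n choose 3) = real n * (real n - 1) * (real n - 2) / 6"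
  by (simp add: binomial_gbinomial gbinomial_prod_rev numeral_3_eq_3)

section \<open>Total counts under removal of singletons and pairs\<close>

abbreviation total_count :: "(nat \<Rightarrow> nat) \<Rightarrow> nat \<Rightarrow> nat \<Rightarrow> real" where
  "total_count m \<equiv> assembly_count m (\<lambda>_. True)"

abbreviation small_count :: "(nat \<Rightarrow> nat) \<Rightarrow> nat \<Rightarrow> nat \<Rightarrow> nat \<Rightarrow> real" where
  "small_count m j \<equiv> assembly_count m (\<lambda>M. (\<forall>i\<in>#M. i \<le> 3) \<and> count M 3 = j)"

abbreviation large_count :: "(nat \<Rightarrow> nat) \<Rightarrow> nat \<Rightarrow> nat \<Rightarrow> real" where
  "large_count m \<equiv> assembly_count m (\<lambda>M. \<exists>i\<in>#M. i > 3)"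

text \<open>At least \<open>2 * Suc k - n\<close> of the components are singletons, and the
  hypothesis makes this at least \<open>n / 2\<close>. The factor \<open>n\<close> then cancels
  against the \<open>n\<close> choices of the marked element.\<close>

lemma total_count_remove_singleton:
  assumes "3 * n \<le> 4 * Suc k"
  shows "total_count m n (Suc k) \<le> 2 * real (m 1) * total_count m (n - 1) k"
proof (cases "n = 0")
  case True
  have "total_count m n (Suc k) = 0"
  proof (rule assembly_count_eq_0)
    fix M :: "nat multiset" assume M: "0 \<notin># M" "sum_mset M = n" "size M = Suc k"
    have "size M \<le> sum_mset M" by (rule size_count_bounds(5)[OF M(1)])
    thus "\<not> True" unfolding M using True by simp
  qed
  thus ?thesis by (simp add: assembly_count_nonneg)
next
  case False
  have "(2 * real (Suc k) - real n) * total_count m n (Suc k) \<le> 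
        real (n choose 1) * real (m 1) * total_count m (n - 1) k"
  proof (intro assembly_count_marked_block_le)
    fix M :: "nat multiset" assume "0 \<notin># M" "sum_mset M = n" "size M = Suc k"
    thus "2 * real (Suc k) - real n \<le> real (count M 1)"
      using size_count_bounds(1)[of M] by simp
  qed auto
  moreover have "real n / 2 \<le> 2 * real (Suc k) - real n"
    using assms by linarith
  hence "real n / 2 * total_count m n (Suc k) \<le> (2 * real (Suc k) - real n) * total_count m n (Suc k)"
    by (intro mult_right_mono assembly_count_nonneg)
  ultimately have "real n * total_count m n (Suc k) \<le> real n * (2 * real (m 1) * total_count m (n - 1) k)"
    by simp
  thus ?thesis using False by (simp add: mult_le_cancel_left_pos)
qed

lemma total_count_remove_pair:
  "real (n choose 2) * real (m 2) * total_count m (n - 2) k \<le> (real n - real (Suc k)) * total_count m n (Suc k)"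
proof (intro assembly_count_marked_block_ge)
  fix M :: "nat multiset" assume "0 \<notin># M" "sum_mset M = n" "size M = Suc k"
  thus "real (count M 2) \<le> real n - real (Suc k)"
    using size_count_bounds(2)[of M] by simp
qed auto

text \<open>In this range singletons and pairs alone suffice. The induction removes a pair if
  \<open>n\<close> has its largest possible value and a singleton otherwise; either way the range
  condition persists.\<close>

lemma total_count_pos:
  assumes "m 1 > 0" "m 2 > 0" "k \<le> n" "n \<le> 2 * k"
  shows "total_count m n k > 0"
  using assms(3,4)
proof (induction k arbitrary: n)
  case 0
  thus ?case by (simp add: assembly_count_def partition_on_empty block_sizes_def)
next
  case (Suc k)
  show ?case
  proof (cases "n = 2 * Suc k")
    case True
    have "total_count m (n - 2) k > 0" using True by (intro Suc.IH) auto
    hence "0 < real (n choose 2) * real (m 2) * total_count m (n - 2) k"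
      using assms True by (intro mult_pos_pos) (auto simp: zero_less_binomial_iff)
    also note total_count_remove_pair
    finally show ?thesis using True by (auto simp: zero_less_mult_iff)
  next
    case False
    have "total_count m (n - 1) k > 0" using False Suc.prems by (intro Suc.IH) auto
    hence "0 < real (n choose 1) * real (m 1) * total_count m (n - 1) k"
      using assms Suc.prems by (intro mult_pos_pos) auto
    also have "\<dots> \<le> real (Suc k) * total_count m n (Suc k)"
    proof (intro assembly_count_marked_block_ge)
      fix M :: "nat multiset" assume "0 \<notin># M" "size M = Suc k"
      thus "real (count M 1) \<le> real (Suc k)"
        using size_count_bounds(3)[of M] by simp
    qed auto
    finally show ?thesis by (auto simp: zero_less_mult_iff)
  qed
qed

text \<open>Each removal of a pair costs a factor \<open>8 * r / n ^ 2\<close>: at most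
  \<open>r\<close> pairs are present, while about \<open>n ^ 2 / 2\<close> positions are available
  for the marked one as long as few elements have been removed.\<close>

lemma total_count_remove_pairs:
  assumes "m 2 > 0" "n = k + r" "16 * r \<le> n" "s \<le> r"
  shows "total_count m (n - 2 * s) (k - s) \<le> (8 * real r / real n ^ 2) ^ s * total_count m n k"
  using assms(4)
proof (induction s)
  case (Suc s)
  define N K where "N = n - 2 * s" and "K = k - s - 1"
  have K: "k - s = Suc K" "k - Suc s = K" "n - 2 * Suc s = N - 2"
    using Suc.prems assms by (auto simp: N_def K_def)
  have NK: "real N - real (Suc K) \<le> real r" 
    using Suc.prems assms by (simp add: N_def K_def)
  \<comment> \<open>At most \<open>2 * r \<le> n / 8\<close> elements have been removed. The second
    bound uses \<open>n \<ge> 16\<close>, which holds since \<open>r \<ge> 1\<close> here.\<close>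
  have N: "real N \<ge> 7 / 8 * real n" "real N - 1 \<ge> real n / 2" 
    using Suc.prems assms by (auto simp: N_def)
  have npos: "real n > 0" using assms Suc.prems by auto
  have "7 / 8 * real n * (real n / 2) \<le> real N * (real N - 1)"
    using N by (intro mult_mono) auto
  moreover have "real n ^ 2 / 4 \<le> 7 / 8 * real n * (real n / 2)"
    by (simp add: power2_eq_square)
  ultimately have ch: "real n ^ 2 / 8 \<le> real (N choose 2)"
    unfolding real_choose_two by simp
  have m2: "1 \<le> real (m 2)" using assms by simp
  have "real n ^ 2 / 8 * 1 * total_count m (N - 2) K \<le> real (N choose 2) * real (m 2) * total_count m (N - 2) K"
    using ch m2 by (intro mult_right_mono mult_mono assembly_count_nonneg) auto
  also have "\<dots> \<le> (real N - real (Suc K)) * total_count m N (Suc K)"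
    by (rule total_count_remove_pair)
  also have "\<dots> \<le> real r * total_count m N (Suc K)"
    using NK by (intro mult_right_mono assembly_count_nonneg)
  finally have "total_count m (N - 2) K \<le> (8 * real r / real n ^ 2) * total_count m N (Suc K)"
    using npos by (simp add: field_simps)
  also have "\<dots> \<le> (8 * real r / real n ^ 2) * ((8 * real r / real n ^ 2) ^ s * total_count m n k)"
    using Suc by (intro mult_left_mono) (auto simp: N_def K(1)[symmetric])
  finally show ?case unfolding K by (simp add: mult.assoc)
qed auto

text \<open>Removing a singleton lowers \<open>3 * N\<close> by 3 and \<open>4 * K\<close> by 4, so
  the condition for a single removal loses one unit each time. The summand \<open>u\<close> provides
  for \<open>u\<close> removals.\<close>

lemma total_count_remove_singletons:
  assumes "u \<le> K" "3 * N + u \<le> 4 * K"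
  shows "total_count m N K \<le> (2 * real (m 1)) ^ u * total_count m (N - u) (K - u)"
  using assms
proof (induction u)
  case (Suc u)
  obtain K' where K': "K - u = Suc K'" using Suc.prems by (cases "K - u") auto
  have "total_count m N K \<le> (2 * real (m 1)) ^ u * total_count m (N - u) (K - u)"
    using Suc by auto
  also have "\<dots> \<le> (2 * real (m 1)) ^ u * (2 * real (m 1) * total_count m (N - u - 1) K')"
    unfolding K' using Suc.prems K' by (intro mult_left_mono total_count_remove_singleton) auto
  also have "N - u - 1 = N - Suc u" by simp
  also have "K' = K - Suc u" using K' by simp
  finally show ?case by (simp only: power_Suc mult_ac)
qed auto

text \<open>
  A block of size \<open>i\<close> and \<open>i - 2\<close> singletons are traded for \<open>i - 1\<close> blocks of size 2, which preserves
  both \<open>n\<close> and \<open>k\<close>.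
\<close>
lemma marked_block_count_bound:
  assumes m: "m 1 > 0" "m 2 > 0" and B: "B \<ge> 1" "real (m i) \<le> fact i * B ^ i"
    and n: "n = k + r" "16 * r \<le> n" and i: "2 \<le> i" "i \<le> Suc r"
  shows "real (n choose i) * real (m i) * total_count m (n - i) (k - 1) 
     \<le> real n * B * (16 * B * real (m 1) * real r / real n) ^ (i - 1) * total_count m n k"
proof -
  obtain s where s: "i = Suc s" "s \<ge> 1" using i by (cases i) auto
  have npos: "real n > 0" using n i by auto
  have m1: "real (m 1) \<ge> 1" using m by simp
  have T0: "total_count m n k \<ge> 0" by (rule assembly_count_nonneg)
  have "total_count m (n - i) (k - 1) \<le> (2 * real (m 1)) ^ (i - 2) * total_count m (n - i - (i - 2)) (k - 1 - (i - 2))"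
    using n i by (intro total_count_remove_singletons) auto
  \<comment> \<open>The block and the \<open>i - 2\<close> singletons together have
    \<open>2 * (i - 1)\<close> elements and form \<open>i - 1\<close> components, exactly like
    \<open>s\<close> pairs.\<close>
  also have "n - i - (i - 2) = n - 2 * s" using s n i by simp
  also have "k - 1 - (i - 2) = k - s" using s i by simp
  also have "total_count m (n - 2 * s) (k - s) \<le> (8 * real r / real n ^ 2) ^ s * total_count m n k"
    using m n s i by (intro total_count_remove_pairs) auto
  also have "(2 * real (m 1)) ^ (i - 2) \<le> (2 * real (m 1)) ^ s"
    using m1 s by (intro power_increasing) auto
  finally have T: "total_count m (n - i) (k - 1) \<le> (2 * real (m 1)) ^ s * ((8 * real r / real n ^ 2) ^ s * total_count m n k)"
    using T0 by (simp add: mult_left_mono mult_right_mono)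
  have C: "real (n choose i) * real (m i) \<le> real n ^ i * B ^ i"
  proof -
    have "real (n choose i) * real (m i) \<le> real (n choose i) * (fact i * B ^ i)"
      using B by (intro mult_left_mono) auto
    also have "\<dots> = real ((n choose i) * fact i) * B ^ i" by simp
    \<comment> \<open>The factor \<open>fact i\<close> allowed in the bound for \<open>m i\<close>
      is absorbed by the binomial coefficient.\<close>
    also have "\<dots> \<le> real (n ^ i) * B ^ i"
      using B binomial_fact_pow[of n i] by (intro mult_right_mono) (auto simp del: of_nat_mult of_nat_power)
    finally show ?thesis by simp
  qed
  have "real (n choose i) * real (m i) * total_count m (n - i) (k - 1) \<le>
        (real n ^ i * B ^ i) * ((2 * real (m 1)) ^ s * ((8 * real r / real n ^ 2) ^ s * total_count m n k))"
    using T C B by (intro mult_mono[OF C T]) (auto simp: assembly_count_nonneg)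
  \<comment> \<open>Since \<open>i = s + 1\<close>, one factor \<open>n * B\<close> stays outside
    and everything else is an \<open>s\<close>-th power whose base is of order
    \<open>r / n\<close>.\<close>
  also have "\<dots> = real n * B * (real n * B * (2 * real (m 1)) * (8 * real r / real n ^ 2)) ^ s * total_count m n k"
    by (simp only: s power_mult_distrib power_Suc mult_ac)
  also have "real n * B * (2 * real (m 1)) * (8 * real r / real n ^ 2) = 16 * B * real (m 1) * real r / real n"
    using npos by (simp add: field_simps power2_eq_square)
  finally show ?thesis by (simp add: s)
qed

section \<open>Assemblies with a component of size at least 4, and the recurrence for the
  others\<close>

lemma sum_geometric_tail:
  fixes y :: real
  assumes "0 \<le> y" "y \<le> 1 / 2" "N \<ge> 3"
  shows "(\<Sum>i\<in>{4..N}. y ^ (i - 1)) \<le> 2 * y ^ 3 - 2 * y ^ N"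
  using assms(3)
proof (induction N rule: dec_induct)
  case (step N)
  \<comment> \<open>The negative term of the claim makes the induction close: the new summand
    \<open>y ^ N\<close> is at most \<open>2 * y ^ N - 2 * y ^ Suc N\<close>.\<close>
  have "y * y ^ N \<le> 1 / 2 * y ^ N" using assms by (intro mult_right_mono) auto
  thus ?case using step by simp
qed auto

text \<open>This is a first moment bound: an assembly with a large component is counted at least
  once in the sum of \<open>D_i\<close> over \<open>i \<ge> 4\<close>. The terms decay
  geometrically, so the size 4 with its cube dominates. For \<open>r\<close> of order
  \<open>sqrt n\<close> the bound is of order \<open>1 / sqrt n\<close> relative to the
  total.\<close>

lemma large_count_bound:
  assumes m: "m 1 > 0" "m 2 > 0" and B: "B \<ge> 1" "\<And>i. i \<ge> 1 \<Longrightarrow> real (m i) \<le> fact i * B ^ i"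
    and n: "n = k + r" "16 * r \<le> n" and k: "k \<ge> 1"
    and y: "16 * B * real (m 1) * real r / real n \<le> 1 / 2"
  shows "large_count m n k \<le> 2 * real n * B * (16 * B * real (m 1) * real r / real n) ^ 3 * total_count m n k"
proof -
  define y where "y = 16 * B * real (m 1) * real r / real n"
  have y0: "0 \<le> y" "y \<le> 1 / 2" using assms by (auto simp: y_def)
  define w where "w P = (if size (block_sizes P) = k then real (\<Prod>i\<in>#block_sizes P. m i) else 0)" for P
  have Suck: "Suc (k - 1) = k" using k by simp
  have "large_count m n k \<le> (\<Sum>P | partition_on {1..n} P. \<Sum>i\<in>{4..Suc r}. real (count (block_sizes P) i) * w P)"
    unfolding assembly_count_def
  proof (rule sum_mono)
    fix P assume "P \<in> {P. partition_on {1..n} P}"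
    hence P: "0 \<notin># block_sizes P" "sum_mset (block_sizes P) = n"
      by (auto simp: partition_block_sizes)
    show "(if size (block_sizes P) = k \<and> (\<exists>i\<in>#block_sizes P. 3 < i)
          then real (\<Prod>i\<in>#block_sizes P. m i) else 0)
         \<le> (\<Sum>i\<in>{4..Suc r}. real (count (block_sizes P) i) * w P)" (is "?L \<le> ?R")
    proof (cases "size (block_sizes P) = k \<and> (\<exists>i\<in>#block_sizes P. 3 < i)")
      case True
      then obtain i where i: "i \<in># block_sizes P" "3 < i" by auto
      \<comment> \<open>A component of size \<open>i\<close> alone contributes \<open>i - 1\<close>
        to \<open>n - k = r\<close>.\<close>
      have "i \<in> {4..Suc r}" using size_count_bounds(4)[OF P(1) i(1)] P(2) True n i by auto
      hence "real (count (block_sizes P) i) * w P \<le> ?R"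
        by (intro member_le_sum) (auto simp: w_def)
      moreover have "1 * w P \<le> real (count (block_sizes P) i) * w P"
        using i(1) by (intro mult_right_mono) (auto simp: w_def Suc_le_eq simp flip: One_nat_def)
      ultimately show ?thesis using True by (simp add: w_def)
    next
      case False
      hence "?L = 0" by (simp only: if_False)
      also have "0 \<le> ?R" by (intro sum_nonneg) (simp add: w_def)
      finally show ?thesis .
    qed
  qed
  also have "\<dots> = (\<Sum>i\<in>{4..Suc r}. \<Sum>P | partition_on {1..n} P. real (count (block_sizes P) i) * w P)"
    by (rule sum.swap)
  also have "\<dots> = (\<Sum>i\<in>{4..Suc r}. real (n choose i) * real (m i) * total_count m (n - i) (k - 1))"
    using assembly_count_marked_block[where R = "\<lambda>_. True" and k = "k - 1" and n = n and m = m, unfolded Suck]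
    by (intro sum.cong refl) (simp add: w_def)
  also have "\<dots> \<le> (\<Sum>i\<in>{4..Suc r}. real n * B * total_count m n k * y ^ (i - 1))"
  proof (rule sum_mono)
    fix i assume "i \<in> {4..Suc r}"
    thus "real (n choose i) * real (m i) * total_count m (n - i) (k - 1)
         \<le> real n * B * total_count m n k * y ^ (i - 1)"
      using marked_block_count_bound[of m B i n k r] assms by (simp add: y_def mult_ac)
  qed
  also have "\<dots> = real n * B * total_count m n k * (\<Sum>i\<in>{4..Suc r}. y ^ (i - 1))"
    by (simp only: sum_distrib_left)
  also have "\<dots> \<le> real n * B * total_count m n k * (2 * y ^ 3)"
  proof (rule mult_left_mono)
    show "(\<Sum>i\<in>{4..Suc r}. y ^ (i - 1)) \<le> 2 * y ^ 3"
    \<comment> \<open>For \<open>r < 2\<close> the range of sizes is empty and the tail estimate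
      does not apply.\<close>
    proof (cases "r \<ge> 2")
      case True
      thus ?thesis using sum_geometric_tail[OF y0, of "Suc r"] zero_le_power[OF y0(1), of "Suc r"] by linarith
    qed (use y0 in auto)
    show "0 \<le> real n * B * total_count m n k"
      using B by (simp add: assembly_count_nonneg)
  qed
  also have "\<dots> = 2 * real n * B * y ^ 3 * total_count m n k" by (simp only: mult_ac)
  finally show ?thesis unfolding y_def .
qed

text \<open>Removing a 3 and then a 1 from the class \<open>Suc j\<close>, or two 2s from the class
  \<open>j\<close>, leads to the same class with \<open>n - 4\<close> elements and
  \<open>k - 2\<close> components. All four removals are exact, and the binomial factors of the two
  routes cancel up to a constant.\<close>

lemma small_count_recurrence:
  assumes m2: "m 2 > 0" and k: "k \<ge> 2" and n: "n = k + r" "n \<ge> 4"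
  shows "3 * real (m 2) ^ 2 * real (Suc j) * (real n - 2 * real r + real j + 1) * small_count m (Suc j) n k =
         2 * real (m 1) * real (m 3) * ((real r - 2 * real j) * (real r - 2 * real j - 1)) * small_count m j n k"
proof -
  obtain k' where k': "k = Suc (Suc k')" using k by (metis Suc_le_D numeral_2_eq_2 Suc_le_mono)
  define R where "R j M \<longleftrightarrow> (\<forall>i\<in>#M. i \<le> 3) \<and> count M 3 = j" for j and M :: "nat multiset"
  \<comment> \<open>With \<open>K = Suc k\<close> components and \<open>D_3 = j\<close>, solving the
    equations of \<open>size_sum_small\<close> gives \<open>D_1 = 2 * K - n + j\<close> here and
    \<open>D_2 = n - K - 2 * j\<close> in \<open>E2\<close>.\<close>
  have E1: "(2 * real (Suc k) - real n + real j) * assembly_count m (R j) n (Suc k) = 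
            real n * real (m 1) * assembly_count m (R j) (n - 1) k" for n k
  proof -
    have *: "(\<lambda>M. R j (add_mset 1 M)) = R j" by (auto simp: R_def fun_eq_iff)
    show ?thesis
      using assembly_count_marked_block_eq[of 1 n k "R j" "2 * real (Suc k) - real n + real j" m]
            size_sum_small
      by (force simp: * R_def[abs_def])
  qed
  have E2: "(real n - real (Suc k) - 2 * real j) * assembly_count m (R j) n (Suc k) = 
            real (n choose 2) * real (m 2) * assembly_count m (R j) (n - 2) k" for n k
  proof -
    have *: "(\<lambda>M. R j (add_mset 2 M)) = R j" by (auto simp: R_def fun_eq_iff)
    show ?thesis
      using assembly_count_marked_block_eq[of 2 n k "R j" "real n - real (Suc k) - 2 * real j" m]
            size_sum_small
      by (force simp: * R_def[abs_def])
  qed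
  have E3: "real (Suc j) * assembly_count m (R (Suc j)) n (Suc k) = 
            real (n choose 3) * real (m 3) * assembly_count m (R j) (n - 3) k" for n k
  proof -
    have *: "(\<lambda>M. R (Suc j) (add_mset 3 M)) = R j" by (auto simp: R_def fun_eq_iff)
    have "real (Suc j) * assembly_count m (R (Suc j)) n (Suc k) = 
          real (n choose 3) * real (m 3) * assembly_count m (\<lambda>M. R (Suc j) (add_mset 3 M)) (n - 3) k"
      by (rule assembly_count_marked_block_eq) (auto simp: R_def)
    thus ?thesis by (simp only: *)
  qed
  \<comment> \<open>The two routes to \<open>c\<close> run from \<open>a\<close> through
    \<open>b\<close> (pairs) and from \<open>e\<close> through \<open>d\<close> (a triple, then a
    singleton).\<close>
  define a b c d where "a = assembly_count m (R j) n k" and "b = assembly_count m (R j) (n - 2) (Suc k')"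
    and "c = assembly_count m (R j) (n - 4) k'" and "d = assembly_count m (R j) (n - 3) (Suc k')"
  define e where "e = assembly_count m (R (Suc j)) n k"
  define x where "x = real n"
  have x: "x \<ge> 4" using n by (simp add: x_def)
  have sub: "real (n - 2) = x - 2" "real (n - 3) = x - 3" using n by (auto simp: x_def)
  have r: "real r = x - real k" using n by (simp add: x_def)
  have n4: "n - 2 - 2 = n - 4" "n - 3 - 1 = n - 4" by auto
  have e1: "(x - 2 * real r + real j + 1) * d = (x - 3) * real (m 1) * c"
    using E1[of k' "n - 3"] by (simp add: d_def c_def sub n4 r k' algebra_simps)
  have e2: "(real r - 2 * real j) * a = x * (x - 1) / 2 * real (m 2) * b"
    using E2[of n "Suc k'"] by (simp add: a_def b_def sub r k' real_choose_two x_def[symmetric])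
  have e2': "(real r - 2 * real j - 1) * b = (x - 2) * (x - 3) / 2 * real (m 2) * c"
    using E2[of "n - 2" k'] by (simp add: b_def c_def sub r k' n4 real_choose_two x_def[symmetric] algebra_simps)
  have e3: "real (Suc j) * e = x * (x - 1) * (x - 2) / 6 * real (m 3) * d"
    using E3[of n "Suc k'"] by (simp add: e_def d_def k' real_choose_three x_def[symmetric])
  have "3 * real (m 2) ^ 2 * real (Suc j) * (x - 2 * real r + real j + 1) * e =
        3 * real (m 2) ^ 2 * (x - 2 * real r + real j + 1) * (real (Suc j) * e)" by (simp only: mult_ac)
  also have "\<dots> = real (m 2) ^ 2 * (x * (x - 1) * (x - 2) / 2) * real (m 3) * ((x - 2 * real r + real j + 1) * d)"
    unfolding e3 by simp
  also have "\<dots> = 2 * real (m 1) * real (m 3) * (x * (x - 1) / 2 * real (m 2) * ((x - 2) * (x - 3) / 2 * real (m 2) * c))"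
    unfolding e1 by (simp add: power2_eq_square)
  also have "\<dots> = 2 * real (m 1) * real (m 3) * ((real r - 2 * real j - 1) * (x * (x - 1) / 2 * real (m 2) * b))"
    unfolding e2'[symmetric] by (simp only: mult_ac)
  also have "\<dots> = 2 * real (m 1) * real (m 3) * ((real r - 2 * real j) * (real r - 2 * real j - 1)) * a"
    unfolding e2[symmetric] by (simp only: mult_ac)
  finally show ?thesis by (simp add: a_def e_def x_def R_def[abs_def])
qed

text \<open>Each component of size 3 contributes 2 to the excess \<open>n - k\<close>.\<close>

lemma small_count_eq_0:
  assumes "n < k + 2 * j"
  shows "small_count m j n k = 0"
proof (intro assembly_count_eq_0)
  fix M :: "nat multiset" assume "0 \<notin># M" "sum_mset M = n" "size M = k"
  thus "\<not> ((\<forall>i\<in>#M. i \<le> 3) \<and> count M 3 = j)"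
    using size_sum_small[of M] assms by auto
qed

lemma small_count_sums: "(\<lambda>j. small_count m j n k) sums (total_count m n k - large_count m n k)"
proof -
  have "(\<Sum>j\<le>n. small_count m j n k) = total_count m n k - large_count m n k"
    unfolding assembly_count_def sum_subtractf[symmetric]
  proof (subst sum.swap, rule sum.cong[OF refl])
    fix P assume "P \<in> {P. partition_on {1..n} P}"
    hence P: "0 \<notin># block_sizes P" "sum_mset (block_sizes P) = n"
      by (auto simp: partition_block_sizes)
    let ?M = "block_sizes P"
    define w where "w = real (\<Prod>i\<in>#?M. m i)"
    have "(\<Sum>j\<le>n. if size ?M = k \<and> (\<forall>i\<in>#?M. i \<le> 3) \<and> count ?M 3 = j then w else 0)
        = (\<Sum>j\<le>n. if count ?M 3 = j then if size ?M = k \<and> (\<forall>i\<in>#?M. i \<le> 3) then w else 0 else 0)"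
      by (intro sum.cong) auto
    also have "\<dots> = (if size ?M = k \<and> (\<forall>i\<in>#?M. i \<le> 3) then w else 0)"
      using size_sum_small(2)[OF P(1)] P(2) by (auto simp: sum.delta)
    also have "\<dots> = (if size ?M = k \<and> True then w else 0) - (if size ?M = k \<and> (\<exists>i\<in>#?M. 3 < i) then w else 0)"
      by (auto simp: not_le)
    finally show "(\<Sum>j\<le>n. if size ?M = k \<and> (\<forall>i\<in>#?M. i \<le> 3) \<and> count ?M 3 = j then real (\<Prod>i\<in>#?M. m i) else 0)
       = (if size ?M = k \<and> True then real (\<Prod>i\<in>#?M. m i) else 0) - (if size ?M = k \<and> (\<exists>i\<in>#?M. 3 < i) then real (\<Prod>i\<in>#?M. m i) else 0)"
      unfolding w_def .
  qed
  thus ?thesis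
    using sums_finite[of "{..n}" "\<lambda>j. small_count m j n k"] small_count_eq_0[of n k _ m] by (simp add: not_le)
qed

text \<open>At a point \<open>z > 0\<close> inside the disc of convergence the terms of the series
  are bounded by some \<open>D\<close>. As \<open>i \<ge> 1\<close>, the constant can be absorbed
  into the base: \<open>D \<le> max 1 D ^ i\<close>.\<close>

lemma egf_coeff_bound:
  assumes "fps_conv_radius (assembly_egf m) > 0"
  obtains B where "B \<ge> 1" "\<And>i. i \<ge> 1 \<Longrightarrow> real (m i) \<le> fact i * B ^ i"
proof -
  obtain z :: real where z: "0 < ereal z" "ereal z < fps_conv_radius (assembly_egf m)"
    using ereal_dense2[OF assms] by auto
  have "summable (\<lambda>i. fps_nth (assembly_egf m) i * z ^ i)"
    using z by (intro summable_fps) auto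
  hence "Bseq (\<lambda>i. fps_nth (assembly_egf m) i * z ^ i)"
    using summable_LIMSEQ_zero convergent_imp_Bseq convergentI by blast
  then obtain D where D: "\<And>i. \<bar>fps_nth (assembly_egf m) i * z ^ i\<bar> \<le> D"
    unfolding Bseq_def by auto
  have zp: "z > 0" using z by simp
  define E where "E = max 1 D"
  define B where "B = max 1 (E / z)"
  have "real (m i) \<le> fact i * B ^ i" if "i \<ge> 1" for i
  proof -
    have "real (m i) / fact i * z ^ i \<le> D" using D[of i] that zp by (simp add: assembly_egf_def)
    also have "D \<le> E ^ 1" by (simp add: E_def)
    also have "\<dots> \<le> E ^ i" using that by (intro power_increasing) (auto simp: E_def)
    finally have "real (m i) / fact i \<le> (E / z) ^ i" using zp by (simp add: field_simps)
    also have "\<dots> \<le> B ^ i" using zp by (intro power_mono) (auto simp: B_def E_def)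
    finally show ?thesis by (simp add: field_simps)
  qed
  moreover have "B \<ge> 1" by (simp add: B_def)
  ultimately show ?thesis using that by blast
qed

section \<open>Perturbed Poisson weights\<close>

text \<open>Up to the factor \<open>exp L\<close> the series is the second moment of a Poisson
  variable of mean \<open>L\<close>. It arises because errors of size
  \<open>\<epsilon> * (i + 1)\<close> in the ratios accumulate over \<open>i < j\<close> to at most
  \<open>\<epsilon> * j ^ 2\<close>.\<close>

definition poisson_error_const :: "real \<Rightarrow> real" where
  "poisson_error_const L = 1 + 2 * exp L * (1 + (\<Sum>j. real j ^ 2 * L ^ j / fact j))"

lemma summable_square_poisson: "summable (\<lambda>j. real j ^ 2 * L ^ j / fact j)"
proof -
  have ex: "summable (\<lambda>j. \<bar>4 * L\<bar> ^ j / fact j)"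
    using summable_exp[of "\<bar>4*L\<bar>"] by (simp add: field_simps)
  show ?thesis
  proof (rule summable_comparison_test'[OF ex, of 0])
    fix j :: nat
    have "real j \<le> 2 ^ j" by (simp add: less_imp_le)
    hence "real j ^ 2 \<le> (2 ^ j) ^ 2" by (intro power_mono) auto
    also have "\<dots> = 4 ^ j" by (simp add: power2_eq_square power_mult_distrib[symmetric])
    finally have "real j ^ 2 * \<bar>L\<bar> ^ j / fact j \<le> 4 ^ j * \<bar>L\<bar> ^ j / fact j"
      by (intro divide_right_mono mult_right_mono) auto
    thus "norm (real j ^ 2 * L ^ j / fact j) \<le> \<bar>4 * L\<bar> ^ j / fact j"
      by (simp add: abs_mult power_abs power_mult_distrib)
  qed
qed

lemma poisson_error_const_ge_1: "L \<ge> 0 \<Longrightarrow> poisson_error_const L \<ge> 1"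
  unfolding poisson_error_const_def
  using suminf_nonneg[OF summable_square_poisson[of L]] by simp

text \<open>
  Both sequences are first compared after division by their values at 0; these values are then
  recovered from the sums.
\<close>
lemma poisson_approx:
  fixes q l :: "nat \<Rightarrow> real"
  assumes rec: "\<And>j. real (Suc j) * q (Suc j) = l j * q j"
    and l: "\<And>j. 0 \<le> l j" "\<And>j. l j \<le> L"
    and err: "\<And>j. \<bar>l j - \<mu>\<bar> \<le> \<epsilon> * real (Suc j)"
    and mu: "0 \<le> \<mu>" "\<mu> \<le> L" and L: "1 \<le> L"
    and q: "q sums (1 - \<delta>)" and \<delta>: "0 \<le> \<delta>" "\<delta> < 1"
  shows "summable (\<lambda>j. \<bar>q j - \<mu> ^ j / fact j * exp (-\<mu>)\<bar>)"
    and "(\<Sum>j. \<bar>q j - \<mu> ^ j / fact j * exp (-\<mu>)\<bar>) \<le> poisson_error_const L * (\<epsilon> + \<delta>)"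
proof -
  \<comment> \<open>\<open>x\<close> and \<open>y\<close> are the two weight sequences normalised to
    1 at 0, and \<open>e\<close> dominates their difference per unit of
    \<open>\<epsilon>\<close>.\<close>
  define x where "x j = (\<Prod>i<j. l i) / fact j" for j
  define y where "y j = \<mu> ^ j / fact j" for j
  define e where "e j = real j ^ 2 * L ^ j / fact j" for j
  have eps: "\<epsilon> \<ge> 0" using err[of 0] by simp
  have xS: "real (Suc j) * x (Suc j) = l j * x j" for j
    by (simp add: x_def del: of_nat_Suc)
  have yS: "real (Suc j) * y (Suc j) = \<mu> * y j" for j
    by (simp add: y_def del: of_nat_Suc)
  have x0: "x j \<ge> 0" for j by (auto simp: x_def l intro!: divide_nonneg_pos prod_nonneg)
  have y0: "y j \<ge> 0" for j using mu by (auto simp: y_def)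
  have yL: "y j \<le> L ^ j / fact j" for j
    using mu by (auto simp: y_def intro!: divide_right_mono power_mono)
  have qx: "q j = q 0 * x j" for j
  proof (induction j)
    case (Suc j)
    have "real (Suc j) * q (Suc j) = real (Suc j) * (q 0 * x (Suc j))"
      using rec[of j] Suc xS[of j] by (metis mult.left_commute)
    thus ?case by simp
  qed (simp add: x_def)
  have xy: "\<bar>x j - y j\<bar> \<le> \<epsilon> * e j" for j
  proof (induction j)
    case 0 thus ?case by (simp add: x_def y_def e_def)
  next
    case (Suc j)
    have "real (Suc j) * \<bar>x (Suc j) - y (Suc j)\<bar> = \<bar>real (Suc j) * x (Suc j) - real (Suc j) * y (Suc j)\<bar>"
      by (simp add: abs_mult right_diff_distrib[symmetric])
    \<comment> \<open>The error splits into the inherited one, multiplied by the ratio, and the new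
      one from replacing \<open>l j\<close> by \<open>\<mu>\<close>.\<close>
    also have "\<dots> = \<bar>l j * (x j - y j) + (l j - \<mu>) * y j\<bar>"
      by (simp only: xS yS) (simp add: algebra_simps)
    also have "\<dots> \<le> l j * \<bar>x j - y j\<bar> + \<bar>l j - \<mu>\<bar> * y j"
      using abs_triangle_ineq[of "l j * (x j - y j)" "(l j - \<mu>) * y j"] l(1)[of j] y0[of j]
      by (simp add: abs_mult)
    also have "\<dots> \<le> L * (\<epsilon> * e j) + (\<epsilon> * real (Suc j)) * (L ^ j / fact j)"
      using l[of j] err[of j] yL[of j] y0[of j] Suc L eps by (intro add_mono mult_mono) auto
    also have "\<dots> = \<epsilon> * (L ^ Suc j * real j ^ 2 + L ^ j * real (Suc j)) / fact j"
      by (simp add: e_def field_simps)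
    also have "\<dots> \<le> \<epsilon> * (L ^ Suc j * real j ^ 2 + L ^ Suc j * real (Suc j)) / fact j"
      using L eps by (intro divide_right_mono mult_left_mono add_mono mult_right_mono) auto
    also have "\<dots> \<le> \<epsilon> * (L ^ Suc j * real (Suc j) ^ 2) / fact j"
    proof -
      \<comment> \<open>This inequality is why a quadratic factor in \<open>e\<close>
        suffices.\<close>
      have "real j ^ 2 + real (Suc j) \<le> real (Suc j) ^ 2"
        by (simp add: power2_eq_square algebra_simps)
      hence "L ^ Suc j * (real j ^ 2 + real (Suc j)) \<le> L ^ Suc j * real (Suc j) ^ 2"
        using L by (intro mult_left_mono) auto
      thus ?thesis using eps by (intro divide_right_mono mult_left_mono) (auto simp: distrib_left)
    qed
    also have "\<dots> = real (Suc j) * (\<epsilon> * e (Suc j))"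
      by (simp add: e_def mult_ac del: of_nat_Suc)
    finally show ?case by (simp add: mult_le_cancel_left_pos)
  qed
  have se: "summable e" unfolding e_def by (rule summable_square_poisson)
  define E where "E = suminf e"
  have E0: "E \<ge> 0" unfolding E_def using L by (intro suminf_nonneg se) (auto simp: e_def)
  have sxy: "summable (\<lambda>j. \<bar>x j - y j\<bar>)"
    using xy by (intro summable_comparison_test'[OF summable_mult[OF se, of \<epsilon>], of 0]) auto
  have sy: "y sums exp \<mu>" unfolding y_def using exp_converges[of \<mu>] by (simp add: field_simps)
  have smx: "summable x"
    using summable_add[OF summable_rabs_cancel[OF sxy] sums_summable[OF sy]] by simp
  define X where "X = suminf x"
  define Y where "Y = exp \<mu>"
  have Y1: "Y \<ge> 1" using mu by (simp add: Y_def)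
  have X1: "X \<ge> 1"
    unfolding X_def using sum_le_suminf[OF smx, of "{0}"] x0 by (simp add: x_def)
  have XY: "\<bar>X - Y\<bar> \<le> \<epsilon> * E"
  proof -
    have "X - Y = (\<Sum>j. x j - y j)"
      unfolding X_def Y_def using suminf_diff[OF smx sums_summable[OF sy]] sums_unique[OF sy] by simp
    also have "\<bar>\<dots>\<bar> \<le> (\<Sum>j. \<bar>x j - y j\<bar>)" by (rule summable_rabs[OF sxy])
    also have "\<dots> \<le> (\<Sum>j. \<epsilon> * e j)" by (intro suminf_le xy sxy summable_mult se)
    finally show ?thesis by (simp add: E_def suminf_mult se)
  qed
  have "(\<lambda>j. q 0 * x j) sums (q 0 * X)"
    unfolding X_def by (intro sums_mult summable_sums smx)
  also have "(\<lambda>j. q 0 * x j) = q" by (rule ext) (rule qx[symmetric])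
  finally have "q sums (q 0 * X)" .
  \<comment> \<open>The known total mass fixes \<open>q 0\<close>, to be compared with the Poisson
    value \<open>1 / Y = exp (- \<mu>)\<close>.\<close>
  hence q0X: "q 0 * X = 1 - \<delta>" using q sums_unique2 by blast
  hence q0: "q 0 = (1 - \<delta>) / X" using X1 by (simp add: field_simps)
  have q01: "0 \<le> q 0" "q 0 \<le> 1" unfolding q0 using X1 \<delta> by (auto simp: divide_simps)
  have q0Y: "\<bar>q 0 - 1 / Y\<bar> \<le> \<delta> + \<epsilon> * E"
  proof -
    \<comment> \<open>The first term is the discrepancy of the normalising sums, the second the
      missing mass.\<close>
    have "q 0 - 1 / Y = (Y - X) / (X * Y) - \<delta> / X"
      unfolding q0 using X1 Y1 by (simp add: field_simps)
    also have "\<bar>\<dots>\<bar> \<le> \<bar>(Y - X) / (X * Y)\<bar> + \<bar>\<delta> / X\<bar>" by (rule abs_triangle_ineq4)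
    also have "\<bar>(Y - X) / (X * Y)\<bar> \<le> \<bar>Y - X\<bar> / 1"
      unfolding abs_divide using X1 Y1 mult_mono[of 1 X 1 Y] by (intro divide_left_mono) (auto simp: abs_mult)
    also have "\<bar>\<delta> / X\<bar> \<le> \<delta> / 1"
      unfolding abs_divide using X1 \<delta> by (intro frac_le) auto
    finally show ?thesis using XY by simp
  qed
  have bd: "\<bar>q j - \<mu> ^ j / fact j * exp (-\<mu>)\<bar> \<le> \<epsilon> * e j + (\<delta> + \<epsilon> * E) * y j" for j
  proof -
    have "q j - \<mu> ^ j / fact j * exp (-\<mu>) = q 0 * (x j - y j) + (q 0 - 1 / Y) * y j"
      by (subst qx) (simp add: y_def Y_def exp_minus field_simps)
    also have "\<bar>\<dots>\<bar> \<le> q 0 * \<bar>x j - y j\<bar> + \<bar>q 0 - 1 / Y\<bar> * y j"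
      using abs_triangle_ineq[of "q 0 * (x j - y j)" "(q 0 - 1 / Y) * y j"] q01(1) y0[of j]
      by (simp add: abs_mult)
    also have "\<dots> \<le> 1 * (\<epsilon> * e j) + (\<delta> + \<epsilon> * E) * y j"
      using q01 xy[of j] q0Y y0[of j] by (intro add_mono mult_mono) auto
    finally show ?thesis by simp
  qed
  have s2: "(\<lambda>j. \<epsilon> * e j + (\<delta> + \<epsilon> * E) * y j) sums (\<epsilon> * E + (\<delta> + \<epsilon> * E) * Y)"
    unfolding E_def Y_def by (intro sums_add sums_mult summable_sums se sy)
  show s1: "summable (\<lambda>j. \<bar>q j - \<mu> ^ j / fact j * exp (-\<mu>)\<bar>)"
    using bd by (intro summable_comparison_test'[OF sums_summable[OF s2], of 0]) auto
  have "(\<Sum>j. \<bar>q j - \<mu> ^ j / fact j * exp (-\<mu>)\<bar>) \<le> \<epsilon> * E + (\<delta> + \<epsilon> * E) * Y"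
    using suminf_le[OF bd s1 sums_summable[OF s2]] sums_unique[OF s2] by simp
  also have "\<dots> \<le> poisson_error_const L * (\<epsilon> + \<delta>)"
  proof -
    have YL: "Y \<le> exp L" using mu by (simp add: Y_def)
    have "\<epsilon> * E * 1 \<le> \<epsilon> * E * exp L" using eps E0 L by (intro mult_left_mono) auto
    moreover have "(\<delta> + \<epsilon> * E) * Y \<le> (\<delta> + \<epsilon> * E) * exp L"
      using eps E0 \<delta> YL by (intro mult_left_mono) auto
    moreover have "poisson_error_const L * (\<epsilon> + \<delta>) = (\<epsilon> + \<delta>) + 2 * exp L * \<epsilon> + 2 * (exp L * \<delta>) 
          + 2 * (\<epsilon> * E * exp L) + 2 * (exp L * E * \<delta>)"
      by (simp add: poisson_error_const_def E_def e_def[abs_def] algebra_simps)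
    moreover have "0 \<le> exp L * E * \<delta>" "0 \<le> exp L * \<epsilon>" "0 \<le> exp L * \<delta>" using E0 \<delta> eps by auto
    moreover have "(\<delta> + \<epsilon> * E) * exp L = exp L * \<delta> + \<epsilon> * E * exp L" by (simp add: algebra_simps)
    ultimately show ?thesis using \<delta> eps by linarith
  qed
  finally show "(\<Sum>j. \<bar>q j - \<mu> ^ j / fact j * exp (-\<mu>)\<bar>) \<le> poisson_error_const L * (\<epsilon> + \<delta>)" .
qed

section \<open>Total variation distance\<close>

lemma sums_prob_nat_pmf:
  fixes p :: "nat pmf"
  shows "(\<lambda>j. if j \<in> A then pmf p j else 0) sums measure_pmf.prob p A"
proof -
  have "(\<lambda>j. measure_pmf.prob p (A \<inter> {j})) sums measure_pmf.prob p (\<Union>j. A \<inter> {j})"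
    by (intro measure_pmf.finite_measure_UNION) (auto simp: disjoint_family_on_def)
  also have "(\<Union>j. A \<inter> {j}) = A" by auto
  also have "(\<lambda>j. measure_pmf.prob p (A \<inter> {j})) = (\<lambda>j. if j \<in> A then pmf p j else 0)"
    by (auto simp: fun_eq_iff measure_pmf_single)
  finally show ?thesis .
qed

lemma pmf_nat_sums: "pmf p sums (1::real)" for p :: "nat pmf"
  using sums_prob_nat_pmf[of UNIV p] by simp

text \<open>The sharp bound has an additional factor 1/2; dropping it affects only
  constants.\<close>

lemma abs_prob_diff_le:
  fixes p q :: "nat pmf"
  shows "\<bar>measure_pmf.prob p A - measure_pmf.prob q A\<bar> \<le> (\<Sum>j. \<bar>pmf p j - pmf q j\<bar>)"
proof -
  have s: "summable (\<lambda>j. \<bar>pmf p j - pmf q j\<bar>)"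
  proof (rule summable_comparison_test'[where g = "\<lambda>j. pmf p j + pmf q j" and N = 0])
    show "summable (\<lambda>j. pmf p j + pmf q j)"
      by (intro summable_add sums_summable[OF pmf_nat_sums])
    show "norm \<bar>pmf p j - pmf q j\<bar> \<le> pmf p j + pmf q j" for j
      using pmf_nonneg[of p j] pmf_nonneg[of q j] unfolding real_norm_def abs_abs by linarith
  qed
  let ?d = "\<lambda>j. (if j \<in> A then pmf p j else 0) - (if j \<in> A then pmf q j else 0)"
  have d: "?d sums (measure_pmf.prob p A - measure_pmf.prob q A)"
    by (intro sums_diff sums_prob_nat_pmf)
  have sd: "summable (\<lambda>j. \<bar>?d j\<bar>)"
    by (intro summable_comparison_test'[OF s, of 0]) auto
  have "\<bar>measure_pmf.prob p A - measure_pmf.prob q A\<bar> = \<bar>suminf ?d\<bar>"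
    using d by (simp add: sums_iff)
  also have "\<dots> \<le> (\<Sum>j. \<bar>?d j\<bar>)" by (rule summable_rabs[OF sd])
  also have "\<dots> \<le> (\<Sum>j. \<bar>pmf p j - pmf q j\<bar>)" by (intro suminf_le s sd) auto
  finally show ?thesis .
qed

lemma total_variation_le:
  assumes "\<And>A. \<bar>measure_pmf.prob p A - measure_pmf.prob q A\<bar> \<le> c"
  shows "total_variation p q \<le> c"
  unfolding total_variation_def by (intro cSUP_least assms) auto

lemma abs_prob_diff_le_total_variation:
  "\<bar>measure_pmf.prob p A - measure_pmf.prob q A\<bar> \<le> total_variation p q"
  unfolding total_variation_def
proof (rule cSUP_upper)
  \<comment> \<open>A supremum of reals bounds the members of its set only if that set is bounded
    above.\<close>
  show "bdd_above (range (\<lambda>A. \<bar>measure_pmf.prob p A - measure_pmf.prob q A\<bar>))"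
  proof (rule bdd_aboveI2[where M = 1])
    fix A
    have "0 \<le> measure_pmf.prob p A" "measure_pmf.prob p A \<le> 1" 
         "0 \<le> measure_pmf.prob q A" "measure_pmf.prob q A \<le> 1" by auto
    thus "\<bar>measure_pmf.prob p A - measure_pmf.prob q A\<bar> \<le> 1" by linarith
  qed
qed auto

lemma total_variation_nonneg: "total_variation p q \<ge> 0"
  using abs_prob_diff_le_total_variation[of p "{}" q] by simp

lemma total_variation_triangle: "total_variation p r \<le> total_variation p q + total_variation q r"
proof (rule total_variation_le)
  fix A
  show "\<bar>measure_pmf.prob p A - measure_pmf.prob r A\<bar> \<le> total_variation p q + total_variation q r"
    using abs_prob_diff_le_total_variation[of p A q] abs_prob_diff_le_total_variation[of q A r] by linarith
qed

text \<open>Poisson weights of mean \<open>a\<close> satisfy the recurrence with the constant ratio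
  \<open>a\<close>, so this is \<open>poisson_approx\<close> with
  \<open>\<epsilon> = \<bar>a - b\<bar>\<close> and no missing mass.\<close>

lemma total_variation_poisson:
  assumes "0 < a" "a \<le> L" "0 < b" "b \<le> L" "1 \<le> L"
  shows "total_variation (poisson_pmf a) (poisson_pmf b) \<le> poisson_error_const L * \<bar>a - b\<bar>"
proof (rule total_variation_le)
  fix A
  have "(\<Sum>j. \<bar>pmf (poisson_pmf a) j - b ^ j / fact j * exp (- b)\<bar>) \<le> poisson_error_const L * (\<bar>a - b\<bar> + 0)"
  proof (rule poisson_approx(2))
    show "pmf (poisson_pmf a) sums (1 - 0)" using pmf_nat_sums by simp
    show "real (Suc j) * pmf (poisson_pmf a) (Suc j) = a * pmf (poisson_pmf a) j" for j
      using assms by (simp del: of_nat_Suc)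
    show "\<bar>a - b\<bar> \<le> \<bar>a - b\<bar> * real (Suc j)" for j
      using mult_left_mono[of 1 "real (Suc j)" "\<bar>a - b\<bar>"] by simp
  qed (use assms in auto)
  thus "\<bar>measure_pmf.prob (poisson_pmf a) A - measure_pmf.prob (poisson_pmf b) A\<bar> \<le> poisson_error_const L * \<bar>a - b\<bar>"
    using abs_prob_diff_le[of "poisson_pmf a" A "poisson_pmf b"] assms by simp
qed

text \<open>A value of the distribution function is the probability of a set of naturals, so the
  distribution functions converge at every point, not only where the limit is continuous.\<close>

lemma total_variation_imp_weak_conv:
  fixes p :: "nat \<Rightarrow> nat pmf"
  assumes "(\<lambda>n. total_variation (p n) q) \<longlonglongrightarrow> 0"
  shows "weak_conv_m (\<lambda>n. distr (measure_pmf (p n)) borel real) (distr (measure_pmf q) borel real)"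
  unfolding weak_conv_m_def weak_conv_def
proof (intro allI impI)
  fix x
  have cdf: "cdf (distr (measure_pmf r) borel real) x = measure_pmf.prob r {j. real j \<le> x}" for r :: "nat pmf"
    by (simp add: cdf_def measure_distr vimage_def)
  have "(\<lambda>n. cdf (distr (measure_pmf (p n)) borel real) x - cdf (distr (measure_pmf q) borel real) x) \<longlonglongrightarrow> 0"
    by (rule Lim_null_comparison[OF _ assms]) (auto simp: cdf abs_prob_diff_le_total_variation)
  thus "(\<lambda>n. cdf (distr (measure_pmf (p n)) borel real) x) \<longlonglongrightarrow> cdf (distr (measure_pmf q) borel real) x"
    by (simp add: LIM_zero_iff)
qed

section \<open>Random assemblies\<close>

text \<open>The event has to agree with \<open>R\<close> only on assemblies, which form the support.
  Positivity of the total count excludes the empty set, where \<open>pmf_of_set\<close> is not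
  meaningful.\<close>

lemma prob_random_assembly:
  assumes "total_count m n k > 0" 
      and "\<And>a. a \<in> assemblies m n k \<Longrightarrow> a \<in> E \<longleftrightarrow> R (block_sizes (fst a))"
  shows "measure_pmf.prob (random_assembly m n k) E = assembly_count m R n k / total_count m n k"
proof -
  have c: "real (card (assemblies m n k)) = total_count m n k"
    using card_assemblies[of m n k "\<lambda>_. True"] by simp
  have "assemblies m n k \<noteq> {}" using c assms(1) by auto
  hence "measure_pmf.prob (random_assembly m n k) E = 
         real (card (assemblies m n k \<inter> E)) / total_count m n k"
    unfolding random_assembly_def by (subst measure_pmf_of_set) (simp_all add: finite_assemblies c)
  also have "assemblies m n k \<inter> E = {a \<in> assemblies m n k. R (block_sizes (fst a))}"
    using assms(2) by auto
  finally show ?thesis by (simp add: card_assemblies)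
qed

lemma assemblies_block_sizes:
  assumes "a \<in> assemblies m n k"
  shows "finite (fst a)" "0 \<notin># block_sizes (fst a)" "sum_mset (block_sizes (fst a)) = n"
        "size (block_sizes (fst a)) = k" "components_of_size i a = count (block_sizes (fst a)) i"
        "largest_component a = Max (set_mset (block_sizes (fst a)))"
proof -
  have P: "partition_on {1..n} (fst a)" "card (fst a) = k" using assms by (auto simp: assemblies_def)
  show f: "finite (fst a)" using P(1) finite_elements by blast
  show "0 \<notin># block_sizes (fst a)" "sum_mset (block_sizes (fst a)) = n"
    using partition_block_sizes[OF P(1)] by auto
  show "size (block_sizes (fst a)) = k" using P by (simp add: size_block_sizes)
  show "components_of_size i a = count (block_sizes (fst a)) i"
    using f by (simp add: components_of_size_def count_block_sizes)
  show "largest_component a = Max (set_mset (block_sizes (fst a)))"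
    using f by (simp add: largest_component_def set_block_sizes)
qed

text \<open>If \<open>k < n\<close>, not all components are singletons, so the largest has size at
  least 2 and only upper bounds on sizes remain to be checked.\<close>

lemma largest_component_2_or_3_iff:
  assumes a: "a \<in> assemblies m n k" and k: "0 < k" "k < n"
  shows "largest_component a \<in> {2, 3} \<longleftrightarrow> (\<forall>i\<in>#block_sizes (fst a). i \<le> 3)"
    and "largest_component a = 2 \<longleftrightarrow> (\<forall>i\<in>#block_sizes (fst a). i \<le> 3) \<and> count (block_sizes (fst a)) 3 = 0"
proof -
  define M where "M = block_sizes (fst a)"
  have M: "0 \<notin># M" "sum_mset M = n" "size M = k" "largest_component a = Max (set_mset M)"
    using assemblies_block_sizes[OF a] by (auto simp: M_def)
  have ne: "set_mset M \<noteq> {}" using M k by auto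
  have le: "Max (set_mset M) \<le> b \<longleftrightarrow> (\<forall>i\<in>#M. i \<le> b)" for b
    using ne by simp
  have in_M: "Max (set_mset M) \<in># M" using ne by simp
  have ge: "2 \<le> Max (set_mset M)"
  proof (rule ccontr)
    assume "\<not> 2 \<le> Max (set_mset M)"
    hence *: "\<forall>i\<in>#M. i \<le> 1" using le[of 1] by simp
    hence "count M 2 = 0" "count M 3 = 0" by (force simp: not_in_iff[symmetric])+
    moreover have "\<forall>i\<in>#M. i \<le> 3" using * by fastforce
    ultimately show False using size_sum_small[OF M(1)] M k by simp
  qed
  show "largest_component a \<in> {2, 3} \<longleftrightarrow> (\<forall>i\<in>#block_sizes (fst a). i \<le> 3)"
    using ge le[of 3] by (auto simp: M M_def[symmetric])
  show "largest_component a = 2 \<longleftrightarrow> (\<forall>i\<in>#block_sizes (fst a). i \<le> 3) \<and> count (block_sizes (fst a)) 3 = 0"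
  proof -
    have "Max (set_mset M) = 2 \<longleftrightarrow> Max (set_mset M) \<le> 3 \<and> count M 3 = 0"
    proof
      assume *: "Max (set_mset M) = 2"
      hence "3 \<notin># M" using le[of 2] by auto
      thus "Max (set_mset M) \<le> 3 \<and> count M 3 = 0" using * by (simp add: not_in_iff)
    next
      assume *: "Max (set_mset M) \<le> 3 \<and> count M 3 = 0"
      hence "Max (set_mset M) \<noteq> 3" using in_M by (metis not_in_iff)
      thus "Max (set_mset M) = 2" using * ge by linarith
    qed
    thus ?thesis using le[of 3] by (simp add: M M_def[symmetric])
  qed
qed

lemma prob_largest_component_2_or_3:
  assumes "total_count m n k > 0" "0 < k" "k < n"
  shows "measure_pmf.prob (random_assembly m n k) {a. largest_component a \<in> {2, 3}} = 
         1 - large_count m n k / total_count m n k"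
    and "measure_pmf.prob (random_assembly m n k) {a. largest_component a = 2} = 
         small_count m 0 n k / total_count m n k"
proof -
  have "measure_pmf.prob (random_assembly m n k) (- {a. largest_component a \<in> {2, 3}}) = 
         large_count m n k / total_count m n k"
    using largest_component_2_or_3_iff(1)[OF _ assms(2,3)] 
    by (intro prob_random_assembly assms) (auto simp: not_le)
  thus "measure_pmf.prob (random_assembly m n k) {a. largest_component a \<in> {2, 3}} = 
         1 - large_count m n k / total_count m n k"
    using measure_pmf.prob_compl[of "{a. largest_component a \<in> {2, 3}}" "random_assembly m n k"]
    by (simp add: Compl_eq_Diff_UNIV)
  show "measure_pmf.prob (random_assembly m n k) {a. largest_component a = 2} = 
         small_count m 0 n k / total_count m n k"
    using largest_component_2_or_3_iff(2)[OF _ assms(2,3)] 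
    by (intro prob_random_assembly assms) auto
qed

text \<open>Restricting to assemblies without large components gives a subprobability
  \<open>q\<close> below the law of \<open>D_3\<close>. The missing mass is the probability of a
  large component, and the triangle inequality adds it to the distance of \<open>q\<close> from the
  Poisson weights.\<close>

lemma total_variation_D3_le:
  assumes T: "total_count m n k > 0" and b: "b > 0"
    and s: "summable (\<lambda>j. \<bar>small_count m j n k / total_count m n k - b ^ j / fact j * exp (-b)\<bar>)"
  shows "total_variation (D3_pmf m n k) (poisson_pmf b) \<le>
     (\<Sum>j. \<bar>small_count m j n k / total_count m n k - b ^ j / fact j * exp (-b)\<bar>) 
       + large_count m n k / total_count m n k"
proof (rule total_variation_le)
  fix A
  define q where "q j = small_count m j n k / total_count m n k" for j
  define \<delta> where "\<delta> = large_count m n k / total_count m n k"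
  define \<pi> where "\<pi> j = b ^ j / fact j * exp (-b)" for j
  have q: "q sums (1 - \<delta>)"
    using sums_divide[OF small_count_sums[of m n k], of "total_count m n k"] T
    by (simp add: q_def[abs_def] \<delta>_def diff_divide_distrib)
  have le: "q j \<le> pmf (D3_pmf m n k) j" for j
  proof -
    have "q j = measure_pmf.prob (random_assembly m n k) 
            {a. (\<forall>i\<in>#block_sizes (fst a). i \<le> 3) \<and> count (block_sizes (fst a)) 3 = j}"
      unfolding q_def by (rule prob_random_assembly[OF T, symmetric]) auto
    \<comment> \<open>\<open>assemblies_block_sizes\<close> identifies
      \<open>components_of_size 3\<close> with the multiset count only for assemblies, hence the
      restriction to the support.\<close>
    also have "\<dots> = measure_pmf.prob (random_assembly m n k) 
            (set_pmf (random_assembly m n k) \<inter> {a. (\<forall>i\<in>#block_sizes (fst a). i \<le> 3) \<and> count (block_sizes (fst a)) 3 = j})"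
      by (subst Int_commute) (rule measure_Int_set_pmf[symmetric])
    also have "\<dots> \<le> measure_pmf.prob (random_assembly m n k) (components_of_size 3 -` {j})"
    proof (rule measure_pmf.finite_measure_mono)
      have "real (card (assemblies m n k)) > 0"
        using card_assemblies[of m n k "\<lambda>_. True"] T by simp
      hence "set_pmf (random_assembly m n k) = assemblies m n k"
        by (simp add: random_assembly_def finite_assemblies card_gt_0_iff)
      thus "set_pmf (random_assembly m n k) \<inter> {a. (\<forall>i\<in>#block_sizes (fst a). i \<le> 3) \<and> count (block_sizes (fst a)) 3 = j}
         \<subseteq> components_of_size 3 -` {j}"
        using assemblies_block_sizes(5) by auto
    qed auto
    also have "\<dots> = pmf (D3_pmf m n k) j"
      by (simp add: D3_pmf_def pmf_map)
    finally show ?thesis .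
  qed
  have "(\<lambda>j. pmf (D3_pmf m n k) j - q j) sums (1 - (1 - \<delta>))"
    by (intro sums_diff q pmf_nat_sums)
  hence d: "(\<lambda>j. pmf (D3_pmf m n k) j - q j) sums \<delta>" by simp
  have s': "summable (\<lambda>j. \<bar>q j - \<pi> j\<bar>)" using s by (simp add: q_def \<pi>_def)
  have sm: "summable (\<lambda>j. \<bar>q j - \<pi> j\<bar> + (pmf (D3_pmf m n k) j - q j))"
    by (intro summable_add s' sums_summable[OF d])
  have bd: "\<bar>pmf (D3_pmf m n k) j - \<pi> j\<bar> \<le> \<bar>q j - \<pi> j\<bar> + (pmf (D3_pmf m n k) j - q j)" for j
    using le[of j] by linarith
  have "\<bar>measure_pmf.prob (D3_pmf m n k) A - measure_pmf.prob (poisson_pmf b) A\<bar>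
        \<le> (\<Sum>j. \<bar>pmf (D3_pmf m n k) j - \<pi> j\<bar>)"
    using abs_prob_diff_le[of "D3_pmf m n k" A "poisson_pmf b"] b by (simp add: \<pi>_def)
  also have "\<dots> \<le> (\<Sum>j. \<bar>q j - \<pi> j\<bar> + (pmf (D3_pmf m n k) j - q j))"
    using bd by (intro suminf_le sm summable_comparison_test'[OF sm, of 0]) auto
  also have "\<dots> = (\<Sum>j. \<bar>q j - \<pi> j\<bar>) + \<delta>"
    using suminf_add[OF s' sums_summable[OF d]] sums_unique[OF d] by simp
  finally show "\<bar>measure_pmf.prob (D3_pmf m n k) A - measure_pmf.prob (poisson_pmf b) A\<bar>
        \<le> (\<Sum>j. \<bar>small_count m j n k / total_count m n k - b ^ j / fact j * exp (-b)\<bar>) 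
       + large_count m n k / total_count m n k"
    by (simp add: q_def \<pi>_def \<delta>_def)
qed

text \<open>These are the hypotheses of \<open>poisson_approx\<close> for the ratio in
  \<open>small_count_recurrence\<close>. The value 0 for \<open>2 * j > r\<close> keeps the ratio
  bounded; there the recurrence survives because \<open>small_count m (Suc j)\<close>
  vanishes.\<close>

lemma poisson_ratio_error:
  fixes r n :: nat and j :: nat and T \<mu> :: real
  assumes "\<mu> \<ge> 0" "T \<ge> 0" "4 * r \<le> n" "n > 0" "real r \<le> T * sqrt (real n)"
  defines "l \<equiv> (if 2 * j \<le> r then \<mu> * ((real r - 2 * real j) * (real r - 2 * real j - 1)) / 
                   (real n - 2 * real r + real j + 1) else 0)"
  shows "0 \<le> l" "l \<le> 2 * \<mu> * T\<^sup>2" "\<mu> * (real r)\<^sup>2 / real n \<le> \<mu> * T\<^sup>2"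
    "\<bar>l - \<mu> * (real r)\<^sup>2 / real n\<bar> \<le> \<mu> * (14 + 4 * T\<^sup>2) * T / sqrt (real n) * real (Suc j)"
proof -
  define x R J where "x = real n" and "R = real r" and "J = real j"
  define D where "D = x - 2 * R + J + 1"
  have x: "x > 0" and R: "R \<ge> 0" "4 * R \<le> x" and J: "J \<ge> 0"
    using assms by (auto simp: x_def R_def J_def)
  have D: "D \<ge> x / 2" "D > 0" using x R J by (auto simp: D_def)
  have R2: "R\<^sup>2 \<le> T\<^sup>2 * x"
  proof -
    have "R\<^sup>2 \<le> (T * sqrt x)\<^sup>2" using assms by (intro power_mono) (auto simp: R_def x_def)
    thus ?thesis using x by (simp add: power_mult_distrib)
  qed
  have Rx: "R / x \<le> T / sqrt x"
  proof -
    have "R / x \<le> T * sqrt x / x" using assms x by (intro divide_right_mono) (auto simp: R_def x_def)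
    also have "\<dots> = T / sqrt x" using x by (simp add: field_simps real_sqrt_mult_self)
    finally show ?thesis .
  qed
  show "\<mu> * (real r)\<^sup>2 / real n \<le> \<mu> * T\<^sup>2"
    using R2 x assms by (simp add: field_simps R_def[symmetric] x_def[symmetric] mult_left_mono)
  have prod: "0 \<le> (R - 2 * J) * (R - 2 * J - 1)" "(R - 2 * J) * (R - 2 * J - 1) \<le> R\<^sup>2" if "2 * j \<le> r"
  proof -
    \<comment> \<open>Integrality matters: \<open>a * (a - 1)\<close> is nonnegative for a natural
      number \<open>a\<close>, but not for a real strictly between 0 and 1.\<close>
    have *: "R - 2 * J = real (r - 2 * j)" using that by (simp add: R_def J_def)
    show "0 \<le> (R - 2 * J) * (R - 2 * J - 1)"
      unfolding * by (cases "r - 2 * j") auto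
    have "(R - 2 * J) * (R - 2 * J - 1) \<le> (R - 2 * J) * (R - 2 * J)"
      unfolding * by (intro mult_left_mono) auto
    also have "\<dots> \<le> R * R" using * J by (intro mult_mono) (auto simp: R)
    finally show "(R - 2 * J) * (R - 2 * J - 1) \<le> R\<^sup>2" by (simp add: power2_eq_square)
  qed
  have l: "l = (if 2 * j \<le> r then \<mu> * ((R - 2 * J) * (R - 2 * J - 1)) / D else 0)"
    by (simp add: l_def R_def J_def D_def x_def)
  show "0 \<le> l" using prod D assms(1) unfolding l by simp
  show "l \<le> 2 * \<mu> * T\<^sup>2"
  proof (cases "2 * j \<le> r")
    case True
    have "l = \<mu> * ((R - 2 * J) * (R - 2 * J - 1)) / D" using True l by simp
    also have "\<dots> \<le> \<mu> * (T\<^sup>2 * x) / (x / 2)"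
      using prod[OF True] R2 D x assms(1) by (intro frac_le mult_left_mono) auto
    finally show ?thesis using x by (simp add: mult_ac)
  qed (use assms in \<open>auto simp: l_def\<close>)
  have "\<bar>l - \<mu> * R\<^sup>2 / x\<bar> \<le> \<mu> * (14 + 4 * T\<^sup>2) * (R / x) * (J + 1)"
  proof (cases "2 * j \<le> r")
    case True
    hence J2: "2 * J \<le> R" by (simp add: J_def R_def)
    \<comment> \<open>This is the difference over the common denominator \<open>x * D\<close>,
      without \<open>\<mu>\<close>. Its leading terms \<open>x * R\<^sup>2\<close> cancel and the
      others are of order \<open>x * R * (J + 1)\<close>. Their coefficients add up to
      \<open>7 + 2 * T\<^sup>2\<close>, doubled below by \<open>D \<ge> x / 2\<close>.\<close>
    define u where "u = x * ((R - 2 * J) * (R - 2 * J - 1)) - R\<^sup>2 * D"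
    have u: "u = x * (2 * J) * (2 * J + 1) + 2 * R * R\<^sup>2 - (x * (4 * J + 1) * R + R * R * (J + 1))"
      unfolding u_def D_def by (simp add: algebra_simps power2_eq_square)
    have "x * (2 * J) * (2 * J + 1) \<le> x * R * (2 * J + 1)"
      using J2 x J by (intro mult_right_mono mult_left_mono) auto
    also have "\<dots> \<le> x * R * (2 * (J + 1))"
      using x R J by (intro mult_left_mono) auto
    finally have u1: "x * (2 * J) * (2 * J + 1) \<le> x * R * (2 * (J + 1))" .
    have "2 * R * R\<^sup>2 \<le> 2 * R * (T\<^sup>2 * x)" using R2 R by (intro mult_left_mono) auto
    also have "\<dots> = x * R * (2 * T\<^sup>2 * 1)" by simp
    also have "\<dots> \<le> x * R * (2 * T\<^sup>2 * (J + 1))"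
      using x R J by (intro mult_left_mono) auto
    finally have u2: "2 * R * R\<^sup>2 \<le> x * R * (2 * T\<^sup>2 * (J + 1))" .
    have u3: "x * (4 * J + 1) * R \<le> x * R * (4 * (J + 1))"
      using mult_left_mono[of "4 * J + 1" "4 * (J + 1)" "x * R"] x R J by (simp add: mult_ac)
    have u4: "R * R * (J + 1) \<le> x * R * (J + 1)"
      using x R J by (intro mult_right_mono) auto
    have pos: "0 \<le> x * (2 * J) * (2 * J + 1)" "0 \<le> 2 * R * R\<^sup>2" "0 \<le> x * (4 * J + 1) * R" "0 \<le> R * R * (J + 1)"
      using x R J by auto
    have "\<bar>u\<bar> \<le> x * R * (2 * (J + 1)) + x * R * (2 * T\<^sup>2 * (J + 1)) + x * R * (4 * (J + 1)) + x * R * (J + 1)"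
      unfolding u using u1 u2 u3 u4 pos by linarith
    hence uu: "\<bar>u\<bar> \<le> x * R * ((7 + 2 * T\<^sup>2) * (J + 1))" by (simp add: algebra_simps)
    have "\<bar>l - \<mu> * R\<^sup>2 / x\<bar> = \<bar>\<mu> * (u / (x * D))\<bar>"
      unfolding l u_def using x D True by (simp add: field_simps)
    also have "\<dots> = \<mu> * (\<bar>u\<bar> / (x * D))" using x D assms by (simp add: abs_mult)
    also have "\<dots> \<le> \<mu> * (x * R * ((7 + 2 * T\<^sup>2) * (J + 1)) / (x * (x / 2)))"
      using uu x D assms R J by (intro mult_left_mono frac_le mult_mono mult_nonneg_nonneg) auto
    also have "\<dots> = \<mu> * (14 + 4 * T\<^sup>2) * (R / x) * (J + 1)"
      using x by (simp add: field_simps)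
    finally show ?thesis .
  next
    case False
    \<comment> \<open>Beyond the cutoff the error is the limit value itself, and a factor
      \<open>R\<close> of it can be traded for \<open>2 * J\<close>.\<close>
    hence J2: "R \<le> 2 * J" by (simp add: J_def R_def)
    have "\<bar>l - \<mu> * R\<^sup>2 / x\<bar> = \<mu> * (R / x) * R"
      using False x R assms by (simp add: l power2_eq_square)
    also have "\<dots> \<le> \<mu> * (R / x) * ((14 + 4 * T\<^sup>2) * (J + 1))"
    proof -
      have "R \<le> 14 * (J + 1)" using J2 J by simp
      also have "\<dots> \<le> (14 + 4 * T\<^sup>2) * (J + 1)" using J by (intro mult_right_mono) auto
      finally show ?thesis using x R assms by (intro mult_left_mono) auto
    qed
    finally show ?thesis by (simp add: mult_ac)
  qed
  also have "\<dots> \<le> \<mu> * (14 + 4 * T\<^sup>2) * (T / sqrt x) * (J + 1)"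
    using Rx assms J by (intro mult_right_mono mult_left_mono) auto
  finally show "\<bar>l - \<mu> * (real r)\<^sup>2 / real n\<bar> \<le> \<mu> * (14 + 4 * T\<^sup>2) * T / sqrt (real n) * real (Suc j)"
    by (simp add: x_def R_def J_def add.commute)
qed

text \<open>For a single pair \<open>n\<close>, \<open>k\<close>, all constants depend only on
  \<open>m\<close>, \<open>B\<close> and \<open>T\<close>; this yields a constant uniform in the
  sequence \<open>k\<close>. The mean \<open>b\<close> is the parameter
  \<open>assembly_lambda\<close> at \<open>exact_t n k\<close>.\<close>

lemma small_count_approx:
  fixes m :: "nat \<Rightarrow> nat" and T B :: real
  assumes m: "m 1 > 0" "m 2 > 0" and B: "B \<ge> 1" "\<forall>i\<ge>1. real (m i) \<le> fact i * B ^ i"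
    and T: "T \<ge> 0"
  defines "\<mu> \<equiv> 2 * real (m 1) * real (m 3) / (3 * real (m 2) ^ 2)"
  defines "L \<equiv> max 1 (2 * \<mu> * T\<^sup>2)" and "c \<equiv> 2 * B * (16 * B * real (m 1) * T) ^ 3"
  assumes n: "n = k + r" "16 * r \<le> n" "4 \<le> n" "k \<ge> 2" and r: "real r \<le> T * sqrt (real n)"
    and small: "16 * B * real (m 1) * T / sqrt (real n) \<le> 1 / 2" "c / sqrt (real n) < 1"
  defines "p \<equiv> total_count m n k" and "b \<equiv> \<mu> * (real r)\<^sup>2 / real n"
  shows "p > 0" and "large_count m n k / p \<le> c / sqrt (real n)" and "0 \<le> b" "b \<le> L"
    and "summable (\<lambda>j. \<bar>small_count m j n k / p - b ^ j / fact j * exp (-b)\<bar>)"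
    and "(\<Sum>j. \<bar>small_count m j n k / p - b ^ j / fact j * exp (-b)\<bar>) 
          \<le> poisson_error_const L * (\<mu> * (14 + 4 * T\<^sup>2) * T + c) / sqrt (real n)"
proof -
  define x where "x = real n"
  have x: "x > 0" using n by (simp add: x_def)
  have xx: "sqrt x * sqrt x = x" "sqrt x > 0" using x by auto
  have mu: "\<mu> \<ge> 0" by (simp add: \<mu>_def)
  show p: "p > 0" unfolding p_def using m n by (intro total_count_pos) auto
  define K where "K = 16 * B * real (m 1)"
  have K: "K \<ge> 0" using B by (simp add: K_def)
  have Rx: "K * real r / x \<le> K * T / sqrt x"
  proof -
    have "K * real r / x \<le> K * (T * sqrt x) / x" 
      using r x K by (intro divide_right_mono mult_left_mono) (auto simp: x_def)
    also have "\<dots> = K * T / sqrt x" using x xx by (simp add: field_simps)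
    finally show ?thesis .
  qed
  define \<delta> where "\<delta> = large_count m n k / p"
  have "large_count m n k \<le> 2 * x * B * (K * real r / x) ^ 3 * p"
  proof -
    have "K * T / sqrt x \<le> 1 / 2" using small(1) by (simp only: K_def x_def)
    hence "K * real r / x \<le> 1 / 2" using Rx by linarith
    thus ?thesis
      unfolding x_def K_def p_def using n(4) by (intro large_count_bound m B(1) B(2)[rule_format] n(1,2)) auto
  qed
  hence "\<delta> \<le> 2 * x * B * (K * real r / x) ^ 3" using p by (simp add: \<delta>_def field_simps)
  also have "\<dots> \<le> 2 * x * B * (K * T / sqrt x) ^ 3"
    using Rx x B K by (intro mult_left_mono power_mono) auto
  \<comment> \<open>One factor \<open>x\<close> meets \<open>x\<close> to the power -3/2; the
    remaining constant is \<open>c\<close>.\<close>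
  also have "\<dots> = c / sqrt x"
  proof -
    have "(K * T / sqrt x) ^ 3 = (K * T) ^ 3 / (x * sqrt x)"
      using xx by (simp add: power_divide power3_eq_cube)
    thus ?thesis using x by (simp add: c_def K_def)
  qed
  finally have \<delta>: "\<delta> \<le> c / sqrt x" .
  show "large_count m n k / p \<le> c / sqrt (real n)" using \<delta> by (simp add: x_def \<delta>_def)
  have \<delta>0: "0 \<le> \<delta>" "\<delta> < 1"
    using p \<delta> small(2) unfolding x_def by (simp_all add: \<delta>_def assembly_count_nonneg del: divide_less_eq_1_pos)
  define l where "l j = (if 2 * j \<le> r then \<mu> * ((real r - 2 * real j) * (real r - 2 * real j - 1)) / 
                   (real n - 2 * real r + real j + 1) else 0)" for j
  have r4: "4 * r \<le> n" and n0: "n > 0" using n by auto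
  note l = poisson_ratio_error[OF mu T r4 n0 r, folded l_def b_def]
  show b: "0 \<le> b" using mu by (simp add: b_def)
  have muT: "0 \<le> \<mu> * T\<^sup>2" using mu by simp
  show bL: "b \<le> L" using l(3) muT by (simp add: L_def max_def)
  define \<epsilon> where "\<epsilon> = \<mu> * (14 + 4 * T\<^sup>2) * T / sqrt x"
  have q: "(\<lambda>j. small_count m j n k / p) sums (1 - \<delta>)"
    using sums_divide[OF small_count_sums[of m n k], of p] p
    by (simp add: p_def[symmetric] \<delta>_def diff_divide_distrib)
  have rec: "real (Suc j) * (small_count m (Suc j) n k / p) = l j * (small_count m j n k / p)" for j
  proof (cases "2 * j \<le> r")
    case False
    hence "small_count m (Suc j) n k = 0" by (intro small_count_eq_0) (use n in auto)
    thus ?thesis using False by (simp add: l_def)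
  next
    case True
    define D where "D = real n - 2 * real r + real j + 1"
    define W where "W = (real r - 2 * real j) * (real r - 2 * real j - 1)"
    have D: "D > 0" using n by (simp add: D_def)
    have m2: "real (m 2) \<noteq> 0" using m by simp
    have lj: "l j = 2 * real (m 1) * real (m 3) * W / (3 * real (m 2) ^ 2 * D)"
      using True by (simp add: l_def \<mu>_def D_def W_def)
    have "3 * real (m 2) ^ 2 * real (Suc j) * D * small_count m (Suc j) n k =
          2 * real (m 1) * real (m 3) * W * small_count m j n k"
      unfolding D_def W_def using m n by (intro small_count_recurrence) auto
    hence "real (Suc j) * small_count m (Suc j) n k * (3 * real (m 2) ^ 2 * D) =
           2 * real (m 1) * real (m 3) * W * small_count m j n k"
      by (simp only: mult_ac)
    hence "real (Suc j) * small_count m (Suc j) n k = 2 * real (m 1) * real (m 3) * W * small_count m j n k / (3 * real (m 2) ^ 2 * D)"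
      using D m2 by (subst eq_divide_eq) auto
    thus ?thesis by (simp add: lj)
  qed
  have err: "\<bar>l j - b\<bar> \<le> \<epsilon> * real (Suc j)" for j
    using l(4)[of j] by (simp add: \<epsilon>_def x_def)
  have lL: "l j \<le> L" for j using l(2)[of j] by (simp add: L_def)
  note approx = poisson_approx[OF rec l(1) lL err b bL _ q \<delta>0]
  show "summable (\<lambda>j. \<bar>small_count m j n k / p - b ^ j / fact j * exp (-b)\<bar>)"
    by (rule approx(1)) (simp add: L_def)
  have "(\<Sum>j. \<bar>small_count m j n k / p - b ^ j / fact j * exp (-b)\<bar>) \<le> poisson_error_const L * (\<epsilon> + \<delta>)"
    by (rule approx(2)) (simp add: L_def)
  also have "\<dots> \<le> poisson_error_const L * (\<epsilon> + c / sqrt x)"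
  proof (rule mult_left_mono)
    have "poisson_error_const L \<ge> 1" by (rule poisson_error_const_ge_1) (simp add: L_def)
    thus "poisson_error_const L \<ge> 0" by simp
  qed (use \<delta> in simp)
  also have "\<dots> = poisson_error_const L * (\<mu> * (14 + 4 * T\<^sup>2) * T + c) / sqrt (real n)"
    unfolding \<epsilon>_def x_def by (simp only: add_divide_distrib[symmetric] times_divide_eq_right)
  finally show "(\<Sum>j. \<bar>small_count m j n k / p - b ^ j / fact j * exp (-b)\<bar>) 
          \<le> poisson_error_const L * (\<mu> * (14 + 4 * T\<^sup>2) * T + c) / sqrt (real n)" .
qed

section \<open>Asymptotics along a component sequence\<close>

lemma component_seq_exact_t:
  assumes "component_seq t k" "t > 0"
  shows "(\<lambda>n. exact_t n (k n)) \<longlonglongrightarrow> t"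
proof -
  \<comment> \<open>Asymptotic equivalence reads 0/0 as 1, so the plain quotient is available only
    where this case is excluded.\<close>
  have "eventually (\<lambda>n. t * sqrt (real n) \<noteq> 0) at_top"
    using eventually_gt_at_top[of 0] by eventually_elim (use assms in auto)
  hence "eventually (\<lambda>n. real n - real (k n) \<noteq> 0 \<or> t * sqrt (real n) \<noteq> 0) at_top"
    by eventually_elim auto
  hence "(\<lambda>n. (real n - real (k n)) / (t * sqrt (real n))) \<longlonglongrightarrow> 1"
    using assms by (intro asymp_equivD_strong) (auto simp: component_seq_def)
  hence "(\<lambda>n. t * ((real n - real (k n)) / (t * sqrt (real n)))) \<longlonglongrightarrow> t * 1"
    by (intro tendsto_mult tendsto_const)
  thus ?thesis using assms(2) by (simp add: exact_t_def)
qed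

text \<open>The constant is chosen before \<open>k\<close>; only the threshold for \<open>n\<close>
  depends on the sequence. The last two estimates measure the change of parameter from
  \<open>exact_t n (k n)\<close> to \<open>t\<close>.\<close>

lemma assembly_approx:
  fixes m :: "nat \<Rightarrow> nat" and t :: real
  assumes m: "m 1 > 0" "m 2 > 0" "m 3 > 0" and conv: "fps_conv_radius (assembly_egf m) > 0" and t: "t > 0"
  obtains C where "C \<ge> 0"
    "\<And>k. component_seq t k \<Longrightarrow> \<forall>\<^sub>F n in at_top.
       \<bar>measure_pmf.prob (random_assembly m n (k n)) {a. largest_component a \<in> {2, 3}} - 1\<bar>
          \<le> C / sqrt (real n) \<and>
       \<bar>measure_pmf.prob (random_assembly m n (k n)) {a. largest_component a = 2}
          - exp (- assembly_lambda (exact_t n (k n)) m)\<bar> \<le> C / sqrt (real n) \<and>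
       total_variation (D3_pmf m n (k n)) (poisson_pmf (assembly_lambda (exact_t n (k n)) m))
          \<le> C / sqrt (real n) \<and>
       \<bar>exp (- assembly_lambda (exact_t n (k n)) m) - exp (- assembly_lambda t m)\<bar>
          \<le> C * \<bar>exact_t n (k n) - t\<bar> \<and>
       total_variation (poisson_pmf (assembly_lambda (exact_t n (k n)) m)) (poisson_pmf (assembly_lambda t m))
          \<le> C * \<bar>exact_t n (k n) - t\<bar>"
proof -
  obtain B where B: "B \<ge> 1" "\<forall>i\<ge>1. real (m i) \<le> fact i * B ^ i"
    using egf_coeff_bound[OF conv] by blast
  define \<mu> where "\<mu> = 2 * real (m 1) * real (m 3) / (3 * real (m 2) ^ 2)"
  \<comment> \<open>Any bound above \<open>t\<close> would do: eventually
    \<open>exact_t n (k n) < T\<close>, that is, \<open>n - k n < T * sqrt n\<close>.\<close>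
  define T where "T = 2 * t"
  define L where "L = max 1 (2 * \<mu> * T\<^sup>2)"
  define c where "c = 2 * B * (16 * B * real (m 1) * T) ^ 3"
  define K where "K = poisson_error_const L"
  define C1 where "C1 = K * (\<mu> * (14 + 4 * T\<^sup>2) * T + c)"
  \<comment> \<open>The means differ by \<open>\<mu> * (s + t) * \<bar>s - t\<bar>\<close> with
    \<open>s = exact_t n (k n)\<close>, and \<open>s + t \<le> 3 * t\<close> since
    \<open>s < 2 * t\<close>.\<close>
  define C2 where "C2 = K * (\<mu> * (3 * t))"
  define C where "C = C1 + c + C2"
  have mu: "\<mu> > 0" using m by (simp add: \<mu>_def)
  have T: "T \<ge> 0" using t by (simp add: T_def)
  have K1: "K \<ge> 1" unfolding K_def by (rule poisson_error_const_ge_1) (simp add: L_def)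
  have c0: "c \<ge> 0" using B T by (simp add: c_def)
  have C10: "C1 \<ge> 0" using mu T c0 K1 by (simp add: C1_def)
  have C20: "C2 \<ge> 0" using mu t K1 by (simp add: C2_def)
  have lam: "assembly_lambda u m = \<mu> * u\<^sup>2" for u by (simp add: assembly_lambda_def \<mu>_def)
  show thesis
  proof (rule that)
    show "C \<ge> 0" using C10 C20 c0 by (simp add: C_def)
    fix k assume k: "component_seq t k"
    have lim: "(\<lambda>n. exact_t n (k n)) \<longlonglongrightarrow> t" by (rule component_seq_exact_t[OF k t])
    have e1: "\<forall>\<^sub>F n in at_top. exact_t n (k n) > 0" using order_tendstoD(1)[OF lim t] .
    have e2: "\<forall>\<^sub>F n in at_top. exact_t n (k n) < T" 
      using order_tendstoD(2)[OF lim, of T] t by (simp add: T_def)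
    have z: "(\<lambda>n. a / sqrt (real n)) \<longlonglongrightarrow> 0" for a :: real by real_asymp
    \<comment> \<open>The next three conditions ensure in turn \<open>16 * r \<le> n\<close>, a
      geometric ratio of at most 1/2, and a probability below 1 of a large component.\<close>
    have e3: "\<forall>\<^sub>F n in at_top. 16 * T / sqrt (real n) < 1" using order_tendstoD(2)[OF z] by auto
    have e4: "\<forall>\<^sub>F n in at_top. 16 * B * real (m 1) * T / sqrt (real n) < 1 / 2" 
      using order_tendstoD(2)[OF z] by auto
    have e5: "\<forall>\<^sub>F n in at_top. c / sqrt (real n) < 1" using order_tendstoD(2)[OF z] by auto
    have e6: "\<forall>\<^sub>F n::nat in at_top. 4 \<le> n" by (rule eventually_ge_at_top)
    show "\<forall>\<^sub>F n in at_top.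
       \<bar>measure_pmf.prob (random_assembly m n (k n)) {a. largest_component a \<in> {2, 3}} - 1\<bar>
          \<le> C / sqrt (real n) \<and>
       \<bar>measure_pmf.prob (random_assembly m n (k n)) {a. largest_component a = 2}
          - exp (- assembly_lambda (exact_t n (k n)) m)\<bar> \<le> C / sqrt (real n) \<and>
       total_variation (D3_pmf m n (k n)) (poisson_pmf (assembly_lambda (exact_t n (k n)) m))
          \<le> C / sqrt (real n) \<and>
       \<bar>exp (- assembly_lambda (exact_t n (k n)) m) - exp (- assembly_lambda t m)\<bar>
          \<le> C * \<bar>exact_t n (k n) - t\<bar> \<and>
       total_variation (poisson_pmf (assembly_lambda (exact_t n (k n)) m)) (poisson_pmf (assembly_lambda t m))
          \<le> C * \<bar>exact_t n (k n) - t\<bar>"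
      using e1 e2 e3 e4 e5 e6
    proof eventually_elim
      case (elim n)
      define s where "s = exact_t n (k n)"
      define r where "r = n - k n"
      have sq: "sqrt (real n) > 0" "sqrt (real n) * sqrt (real n) = real n" using elim(6) by auto
      have s: "0 < s" "s < T" using elim by (auto simp: s_def)
      have ns: "real n - real (k n) = s * sqrt (real n)" using sq by (simp add: s_def exact_t_def)
      hence "real n - real (k n) > 0" using s sq by simp
      hence n: "n = k n + r" "k n < n" by (auto simp: r_def)
      have rs: "real r = s * sqrt (real n)" using ns n by simp
      have rT: "real r \<le> T * sqrt (real n)" unfolding rs using s sq by (intro mult_right_mono) auto
      have "16 * T < sqrt (real n)" using elim(3) sq by (simp add: field_simps)
      hence "16 * T * sqrt (real n) \<le> sqrt (real n) * sqrt (real n)" using sq by (intro mult_right_mono) auto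
      hence "16 * real r \<le> real n" using rT sq by linarith
      hence r16: "16 * r \<le> n" by linarith
      hence k2: "k n \<ge> 2" using n elim(6) by linarith
      define b where "b = \<mu> * s\<^sup>2"
      have b: "\<mu> * (real r)\<^sup>2 / real n = b" 
        using sq elim(6) by (simp add: b_def rs power_mult_distrib)
      have bpos: "b > 0" using mu s by (simp add: b_def)
      have h4: "16 * B * real (m 1) * T / sqrt (real n) \<le> 1 / 2" using elim(4) by simp
      note approx = small_count_approx[OF m(1,2) B T n(1) r16 elim(6) k2 rT, folded \<mu>_def, folded L_def c_def, 
            OF h4 elim(5), folded K_def C1_def, unfolded b]
      let ?p = "total_count m n (k n)"
      define q where "q j = small_count m j n (k n) / ?p" for j
      define S where "S = (\<Sum>j. \<bar>q j - b ^ j / fact j * exp (- b)\<bar>)"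
      define \<delta> where "\<delta> = large_count m n (k n) / ?p"
      have S: "S \<le> C1 / sqrt (real n)" 
        using approx(6) by (simp add: S_def q_def C1_def)
      have \<delta>: "\<delta> \<le> c / sqrt (real n)" "0 \<le> \<delta>"
        using approx(2) approx(1) by (auto simp: \<delta>_def assembly_count_nonneg)
      have sm: "summable (\<lambda>j. \<bar>q j - b ^ j / fact j * exp (- b)\<bar>)"
        using approx(5) by (simp add: q_def)
      have CC: "C1 / sqrt (real n) + c / sqrt (real n) \<le> C / sqrt (real n)"
        unfolding add_divide_distrib[symmetric] using sq C20 by (intro divide_right_mono) (auto simp: C_def)
      have C1n: "0 \<le> C1 / sqrt (real n)" "0 \<le> c / sqrt (real n)" using C10 c0 by auto
      have P: "measure_pmf.prob (random_assembly m n (k n)) {a. largest_component a \<in> {2, 3}} = 1 - \<delta>"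
              "measure_pmf.prob (random_assembly m n (k n)) {a. largest_component a = 2} = q 0"
        unfolding \<delta>_def q_def using approx(1) k2 n(2) 
        by (auto intro!: prob_largest_component_2_or_3 simp del: insert_iff)
      have "\<bar>q 0 - exp (- b)\<bar> \<le> S"
        unfolding S_def using sum_le_suminf[OF sm, of "{0}"] by simp
      hence g2: "\<bar>q 0 - exp (- b)\<bar> \<le> C / sqrt (real n)" using S CC C1n by linarith
      have g1: "\<bar>1 - \<delta> - 1\<bar> \<le> C / sqrt (real n)" using \<delta> CC C1n by simp
      have "total_variation (D3_pmf m n (k n)) (poisson_pmf b) \<le> S + \<delta>"
        unfolding S_def \<delta>_def q_def using approx(1) bpos sm[unfolded q_def] by (rule total_variation_D3_le)
      hence g3: "total_variation (D3_pmf m n (k n)) (poisson_pmf b) \<le> C / sqrt (real n)"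
        using S \<delta> CC by linarith
      have tL: "\<mu> * t\<^sup>2 \<le> L"
      proof -
        have "\<mu> * t\<^sup>2 \<le> 2 * \<mu> * T\<^sup>2" using mu by (simp add: T_def power_mult_distrib)
        thus ?thesis by (simp add: L_def)
      qed
      have "total_variation (poisson_pmf b) (poisson_pmf (\<mu> * t\<^sup>2)) \<le> K * \<bar>b - \<mu> * t\<^sup>2\<bar>"
        unfolding K_def using bpos approx(4) mu t tL by (intro total_variation_poisson) (auto simp: L_def)
      also have "\<bar>b - \<mu> * t\<^sup>2\<bar> = \<mu> * (s + t) * \<bar>s - t\<bar>"
      proof -
        have "b - \<mu> * t\<^sup>2 = \<mu> * (s + t) * (s - t)" by (simp add: b_def power2_eq_square algebra_simps)
        thus ?thesis using mu s t by (simp add: abs_mult)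
      qed
      also have "K * (\<mu> * (s + t) * \<bar>s - t\<bar>) \<le> K * (\<mu> * (3 * t) * \<bar>s - t\<bar>)"
        using K1 mu s by (intro mult_left_mono mult_right_mono) (auto simp: T_def)
      also have "\<dots> = C2 * \<bar>s - t\<bar>" by (simp add: C2_def)
      also have "\<dots> \<le> C * \<bar>s - t\<bar>" using C10 c0 by (intro mult_right_mono) (auto simp: C_def)
      finally have g5: "total_variation (poisson_pmf b) (poisson_pmf (\<mu> * t\<^sup>2)) \<le> C * \<bar>s - t\<bar>" .
      \<comment> \<open>Both exponentials are the Poisson probabilities of the event
        \<open>{0}\<close>.\<close>
      have "\<bar>exp (- b) - exp (- (\<mu> * t\<^sup>2))\<bar> \<le> total_variation (poisson_pmf b) (poisson_pmf (\<mu> * t\<^sup>2))"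
        using abs_prob_diff_le_total_variation[of "poisson_pmf b" "{0}" "poisson_pmf (\<mu> * t\<^sup>2)"] bpos mu t
        by (simp add: measure_pmf_single)
      hence g4: "\<bar>exp (- b) - exp (- (\<mu> * t\<^sup>2))\<bar> \<le> C * \<bar>s - t\<bar>" using g5 by linarith
      show ?case
        unfolding P lam s_def[symmetric] b_def[symmetric] using g1 g2 g3 g4 g5 by blast
    qed
  qed
qed

theorem theorem3p3:
  fixes m :: "nat \<Rightarrow> nat" and t :: real
  assumes "m 1 > 0" and "m 2 > 0" and "m 3 > 0"
    and "fps_conv_radius (assembly_egf m) > 0"
    and "t > 0"
  shows
    "(\<forall>k. component_seq t k \<longrightarrow>
        (\<lambda>n. measure_pmf.prob (random_assembly m n (k n)) {a. largest_component a \<in> {2, 3}})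
          \<longlonglongrightarrow> 1 \<and>
        weak_conv_m
          (\<lambda>n. distr (measure_pmf (D3_pmf m n (k n))) borel real)
          (distr (measure_pmf (poisson_pmf (assembly_lambda t m))) borel real) \<and>
        (\<lambda>n. measure_pmf.prob (random_assembly m n (k n)) {a. largest_component a = 2})
          \<longlonglongrightarrow> exp (- assembly_lambda t m))
     \<and>
     (\<exists>C. \<forall>k. component_seq t k \<longrightarrow>
        (\<forall>\<^sub>F n in at_top.
           \<bar>measure_pmf.prob (random_assembly m n (k n)) {a. largest_component a = 2}
              - exp (- assembly_lambda (exact_t n (k n)) m)\<bar>
             \<le> C * ((ln (real n))\<^sup>2 / sqrt (real n)) \<and>
           total_variation (D3_pmf m n (k n)) (poisson_pmf (assembly_lambda (exact_t n (k n)) m))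
             \<le> C * ((ln (real n))\<^sup>2 / sqrt (real n)) \<and>
           \<bar>measure_pmf.prob (random_assembly m n (k n)) {a. largest_component a = 2}
              - exp (- assembly_lambda t m)\<bar>
             \<le> C * ((ln (real n))\<^sup>2 / sqrt (real n) + \<bar>exact_t n (k n) - t\<bar>) \<and>
           total_variation (D3_pmf m n (k n)) (poisson_pmf (assembly_lambda t m))
             \<le> C * ((ln (real n))\<^sup>2 / sqrt (real n) + \<bar>exact_t n (k n) - t\<bar>)))"
proof -
  obtain C where C: "C \<ge> 0"
    "\<And>k. component_seq t k \<Longrightarrow> \<forall>\<^sub>F n in at_top.
       \<bar>measure_pmf.prob (random_assembly m n (k n)) {a. largest_component a \<in> {2, 3}} - 1\<bar>
          \<le> C / sqrt (real n) \<and>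
       \<bar>measure_pmf.prob (random_assembly m n (k n)) {a. largest_component a = 2}
          - exp (- assembly_lambda (exact_t n (k n)) m)\<bar> \<le> C / sqrt (real n) \<and>
       total_variation (D3_pmf m n (k n)) (poisson_pmf (assembly_lambda (exact_t n (k n)) m))
          \<le> C / sqrt (real n) \<and>
       \<bar>exp (- assembly_lambda (exact_t n (k n)) m) - exp (- assembly_lambda t m)\<bar>
          \<le> C * \<bar>exact_t n (k n) - t\<bar> \<and>
       total_variation (poisson_pmf (assembly_lambda (exact_t n (k n)) m)) (poisson_pmf (assembly_lambda t m))
          \<le> C * \<bar>exact_t n (k n) - t\<bar>"
    using assembly_approx[OF assms] by blast
  have main: "\<forall>\<^sub>F n in at_top.
       \<bar>measure_pmf.prob (random_assembly m n (k n)) {a. largest_component a = 2} - exp (- assembly_lambda t m)\<bar>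
          \<le> C / sqrt (real n) + C * \<bar>exact_t n (k n) - t\<bar> \<and>
       total_variation (D3_pmf m n (k n)) (poisson_pmf (assembly_lambda t m))
          \<le> C / sqrt (real n) + C * \<bar>exact_t n (k n) - t\<bar>"
    if "component_seq t k" for k
    using C(2)[OF that]
  proof eventually_elim
    case (elim n)
    show ?case
      using elim total_variation_triangle[of "D3_pmf m n (k n)" "poisson_pmf (assembly_lambda t m)"
              "poisson_pmf (assembly_lambda (exact_t n (k n)) m)"] by linarith
  qed
  have lim0: "(\<lambda>n. C / sqrt (real n)) \<longlonglongrightarrow> 0" by real_asymp
  have lim1: "(\<lambda>n. C / sqrt (real n) + C * \<bar>exact_t n (k n) - t\<bar>) \<longlonglongrightarrow> 0"
    if "component_seq t k" for k
  proof -
    have "(\<lambda>n. \<bar>exact_t n (k n) - t\<bar>) \<longlonglongrightarrow> 0"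
      using component_seq_exact_t[OF that assms(5)] by (intro tendsto_rabs_zero) (simp add: LIM_zero_iff)
    from tendsto_add[OF lim0 tendsto_mult[OF tendsto_const this, of C]] show ?thesis by simp
  qed
  \<comment> \<open>The rate obtained is \<open>1 / sqrt n\<close>; the logarithmic factor only
    weakens it once \<open>ln n \<ge> 1\<close>.\<close>
  have ln1: "\<forall>\<^sub>F n in at_top. C / sqrt (real n) \<le> C * ((ln (real n))\<^sup>2 / sqrt (real n))"
  proof -
    have "\<forall>\<^sub>F n in at_top. (ln (real n))\<^sup>2 \<ge> 1" by real_asymp
    thus ?thesis
    proof eventually_elim
      case (elim n)
      have "C * (1 / sqrt (real n)) \<le> C * ((ln (real n))\<^sup>2 / sqrt (real n))"
        using elim C(1) by (intro mult_left_mono divide_right_mono) auto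
      thus ?case by simp
    qed
  qed
  show ?thesis
  proof (intro conjI allI impI exI[of _ C])
    fix k assume k: "component_seq t k"
    have "(\<lambda>n. measure_pmf.prob (random_assembly m n (k n)) {a. largest_component a \<in> {2, 3}} - 1) \<longlonglongrightarrow> 0"
      by (rule Lim_null_comparison[OF _ lim0]) (use C(2)[OF k] in eventually_elim, simp)
    thus "(\<lambda>n. measure_pmf.prob (random_assembly m n (k n)) {a. largest_component a \<in> {2, 3}}) \<longlonglongrightarrow> 1"
      by (simp only: LIM_zero_iff)
    show "weak_conv_m (\<lambda>n. distr (measure_pmf (D3_pmf m n (k n))) borel real)
          (distr (measure_pmf (poisson_pmf (assembly_lambda t m))) borel real)"
      by (rule total_variation_imp_weak_conv, rule Lim_null_comparison[OF _ lim1[OF k]])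
         (use main[OF k] in eventually_elim, simp add: total_variation_nonneg)
    have "(\<lambda>n. measure_pmf.prob (random_assembly m n (k n)) {a. largest_component a = 2}
             - exp (- assembly_lambda t m)) \<longlonglongrightarrow> 0"
      by (rule Lim_null_comparison[OF _ lim1[OF k]]) (use main[OF k] in eventually_elim, simp)
    thus "(\<lambda>n. measure_pmf.prob (random_assembly m n (k n)) {a. largest_component a = 2})
          \<longlonglongrightarrow> exp (- assembly_lambda t m)"
      by (simp only: LIM_zero_iff)
    show "\<forall>\<^sub>F n in at_top.
           \<bar>measure_pmf.prob (random_assembly m n (k n)) {a. largest_component a = 2}
              - exp (- assembly_lambda (exact_t n (k n)) m)\<bar>
             \<le> C * ((ln (real n))\<^sup>2 / sqrt (real n)) \<and>
           total_variation (D3_pmf m n (k n)) (poisson_pmf (assembly_lambda (exact_t n (k n)) m))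
             \<le> C * ((ln (real n))\<^sup>2 / sqrt (real n)) \<and>
           \<bar>measure_pmf.prob (random_assembly m n (k n)) {a. largest_component a = 2}
              - exp (- assembly_lambda t m)\<bar>
             \<le> C * ((ln (real n))\<^sup>2 / sqrt (real n) + \<bar>exact_t n (k n) - t\<bar>) \<and>
           total_variation (D3_pmf m n (k n)) (poisson_pmf (assembly_lambda t m))
             \<le> C * ((ln (real n))\<^sup>2 / sqrt (real n) + \<bar>exact_t n (k n) - t\<bar>)"
      using C(2)[OF k] main[OF k] ln1
    proof eventually_elim
      case (elim n)
      thus ?case unfolding distrib_left by linarith
    qed
  qed
qed

end
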